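(* Let $q$ be a complex number with $0<|q|<1$, and for $r\in\{1,5\}$ put $$w_r:=q^{r/2}\frac{f_rf_{21r}}{f_{3r}f_{7r}}.$$ If $P:=w_1w_5$ and $Q:=\dfrac{w_1}{w_5}$, then $$P^2+\frac{1}{P^2}=Q^3+\frac{1}{Q^3}+5\left(Q^2+\frac{1}{Q^2}\right)+20\left(Q+\frac{1}{Q}\right)+5\left(P+\frac{1}{P}\right)\left[\left(Q+\frac{1}{Q}\right)+2\right]+35.$$
   Context: For $|q|<1$, $f(-q):=\sum_{n=-\infty}^{\infty}(-1)^n q^{n(3n-1)/2}$, and $f_n:=f(-q^n)$ for positive integers $n$ (so $f_n$ is $f(-x)$ evaluated at $x=q^n$). A square root $q^{1/2}$ of $q$ is fixed (the positive one if $0<q<1$) and $q^{r/2}:=(q^{1/2})^r$. *)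

theory Defs
  imports "HOL-Analysis.Analysis"
begin

text \<open>
  \<open>f_minus q\<close> is Ramanujan's \<open>f(-q)\<close>: the argument is \<open>q\<close>, not \<open>-q\<close>.
  The exponent \<open>n (3 n - 1) / 2\<close> is a non-negative integer for every integer \<open>n\<close>, so
  neither \<open>div\<close> nor \<open>nat\<close> loses information. The series converges absolutely for
  \<open>norm q < 1\<close>; other arguments are not meaningful.
\<close>

definition f_minus :: "complex \<Rightarrow> complex" where
  "f_minus q = (\<Sum>\<^sub>\<infinity>n\<in>(UNIV :: int set). (-1) powi n * q ^ nat (n * (3 * n - 1) div 2))"

definition f_sub :: "complex \<Rightarrow> nat \<Rightarrow> complex" where
  "f_sub q n = f_minus (q ^ n)"

text \<open>Here \<open>s\<close> is the chosen square root of \<open>q\<close>, so that \<open>s ^ r\<close> is \<open>q\<close> to the power \<open>r/2\<close>.\<close>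

definition w :: "complex \<Rightarrow> complex \<Rightarrow> nat \<Rightarrow> complex" where
  "w q s r = s ^ r * (f_sub q r * f_sub q (21 * r)) / (f_sub q (3 * r) * f_sub q (7 * r))"

end

theory Submission
  imports Defs "HOL-Probability.Probability" "HOL-Complex_Analysis.Complex_Analysis" "HOL-Number_Theory.Cong"
begin

text \<open>
  Put \<open>x = P + 1/P\<close> and \<open>y = Q + 1/Q\<close>. The claim says that
  \<open>F(x, y) = x\<^sup>2 - 5xy - 10x - y\<^sup>3 - 5y\<^sup>2 - 17y - 27\<close> vanishes. With \<open>q = exp(2\<pi>i\<tau>)\<close>, the squares
  \<open>w\<^sub>1\<^sup>2\<close> and \<open>w\<^sub>5\<^sup>2\<close> are quotients of values of \<open>\<eta>\<^sup>2\<close>, and the group \<open>\<Gamma>\<^sub>0(105)+\<close> generated by \<open>\<Gamma>\<^sub>0(105)\<close> and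
  all Atkin--Lehner involutions only swaps them and inverts both. Hence \<open>x\<^sup>2\<close>, \<open>xy\<close>, \<open>y\<^sup>2\<close> and the product
  \<open>F(x, y) F(-x, -y)\<close> are invariant; using this product avoids computing the sign characters of \<open>w\<^sub>1\<close> and \<open>w\<^sub>5\<close>.
  As 105 is squarefree, the group has a single cusp: every \<open>\<tau>\<close> is equivalent to some \<open>z\<close> with
  \<open>Im z \<ge> 1/525\<close>. The factor \<open>F(-x, -y)\<close> has a pole of order 6 in \<open>q\<close>, while \<open>q\<^sup>6 F(x, y) = O(q\<^sup>1\<^sup>3)\<close> by
  comparing coefficients, so the product extends to a holomorphic function on the disc that vanishes at 0
  and attains its maximum modulus. It is therefore 0, and so is \<open>F(x, y)\<close>.

  The transformation law of \<open>\<eta>\<^sup>2\<close> under \<open>\<tau> \<mapsto> -1/\<tau>\<close> comes from Poisson summation for the Gaussian. It also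
  shows, by moving \<open>\<tau>\<close> up in the half-plane, that \<open>f(-q)\<close> has no zeros in the disc.
\<close>

section \<open>The power series of f(-q)\<close>

definition pent :: "int \<Rightarrow> nat" where
  "pent n = nat (n * (3 * n - 1) div 2)"

lemma pent_nonneg: "n * (3 * n - 1) \<ge> (0::int)"
  by (cases "n \<le> 0") (auto intro: mult_nonpos_nonpos)

lemma int_pent: "2 * int (pent n) = n * (3 * n - 1)"
proof -
  have "even (n * (3 * n - 1))" by auto
  then show ?thesis using pent_nonneg[of n] by (simp add: pent_def)
qed

text \<open>Equal values at m and n with m different from n would force 3 (m + n) = 1. Hence no two
  terms of the bilateral series share an exponent.\<close>

lemma inj_pent: "inj pent"
proof (rule injI)
  fix m n assume "pent m = pent n"
  then have "m * (3 * m - 1) = n * (3 * n - 1)" by (metis int_pent)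
  then have "(m - n) * (3 * (m + n) - 1) = 0" by algebra
  moreover have "3 * (m + n) - 1 \<noteq> 0" by presburger
  ultimately show "m = n" by simp
qed

lemma pent_less_13_iff: "pent n < 13 \<longleftrightarrow> n \<in> {-2..3}"
proof
  assume *: "pent n < 13"
  show "n \<in> {-2..3}"
  proof (rule ccontr)
    assume "n \<notin> {-2..3}"
    then consider "n \<le> -3" | "n \<ge> 4" by force
    then have "n * (3 * n - 1) \<ge> 26"
    proof cases
      case 1
      then have "(-n) * (1 - 3 * n) \<ge> 3 * 10" by (intro mult_mono) auto
      then show ?thesis by (simp add: algebra_simps)
    next
      case 2
      then have "n * (3 * n - 1) \<ge> 4 * 11" by (intro mult_mono) auto
      then show ?thesis by simp
    qed
    with * int_pent[of n] show False by linarith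
  qed
next
  assume "n \<in> {-2..3}"
  then have "n \<in> {-2,-1,0,1,2,3}" by force
  then show "pent n < 13" by (auto simp: pent_def)
qed

text \<open>The coefficient of q^k in f(-q). It turns the bilateral series into an ordinary power
  series, to which the theory of holomorphic functions applies.\<close>

definition pcoeff :: "nat \<Rightarrow> complex" where
  "pcoeff k = (if k \<in> range pent then (-1) powi (inv pent k) else 0)"

lemma pcoeff_pent: "pcoeff (pent n) = (-1) powi n"
  by (simp add: pcoeff_def inj_pent)

lemma norm_pcoeff_le: "norm (pcoeff k) \<le> 1"
  by (simp add: pcoeff_def norm_power_int)

lemma pcoeff_0: "pcoeff 0 = 1"
  using pcoeff_pent[of 0] by (simp add: pent_def)

lemma summable_pcoeff:
  assumes "norm q < 1"
  shows "summable (\<lambda>k. norm (pcoeff k * q ^ k))"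
  by (rule summable_comparison_test'[where g = "\<lambda>k. norm q ^ k"])
     (use assms norm_pcoeff_le in \<open>auto intro!: mult_left_le_one_le simp: norm_mult norm_power summable_geometric\<close>)

text \<open>The power series converges absolutely by comparison with a geometric series; reindexing
  along the injective \<open>pent\<close> carries this over to the bilateral sum.\<close>

lemma has_sum_f_minus:
  assumes "norm q < 1"
  shows "((\<lambda>n. (-1) powi n * q ^ pent n) has_sum f_minus q) UNIV"
    and "((\<lambda>k. pcoeff k * q ^ k) has_sum f_minus q) UNIV"
proof -
  have "(\<lambda>k. pcoeff k * q ^ k) summable_on UNIV"
    by (intro norm_summable_imp_summable_on summable_pcoeff assms)
  then have "(\<lambda>k. pcoeff k * q ^ k) summable_on range pent"
    by (rule summable_on_subset_banach) auto
  then have "((\<lambda>k. pcoeff k * q ^ k) \<circ> pent) summable_on UNIV"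
    by (subst summable_on_reindex[symmetric]) (auto simp: inj_pent)
  then have "(\<lambda>n. (-1) powi n * q ^ pent n) summable_on UNIV"
    by (simp add: o_def pcoeff_pent)
  then show *: "((\<lambda>n. (-1) powi n * q ^ pent n) has_sum f_minus q) UNIV"
    by (simp add: f_minus_def pent_def)
  have "(((\<lambda>k. pcoeff k * q ^ k) \<circ> pent) has_sum f_minus q) UNIV"
    using * by (simp add: o_def pcoeff_pent)
  then have "((\<lambda>k. pcoeff k * q ^ k) has_sum f_minus q) (range pent)"
    by (subst has_sum_reindex) (auto simp: inj_pent)
  then show "((\<lambda>k. pcoeff k * q ^ k) has_sum f_minus q) UNIV"
    by (rule has_sum_cong_neutral[THEN iffD1, rotated -1]) (auto simp: pcoeff_def)
qed

lemma f_minus_sums: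
  assumes "norm q < 1"
  shows "(\<lambda>k. pcoeff k * q ^ k) sums f_minus q"
  using has_sum_f_minus(2)[OF assms] by (rule has_sum_imp_sums)

lemma f_minus_holomorphic: "f_minus holomorphic_on ball 0 1"
  by (rule power_series_holomorphic[where a = pcoeff]) (auto intro: f_minus_sums)

lemma f_minus_0 [simp]: "f_minus 0 = 1"
  using sums_unique2[OF f_minus_sums[of 0] powser_sums_zero[of pcoeff]] by (simp add: pcoeff_0)

text \<open>Comparison with a geometric series gives |f(-q) - 1| <= |q| / (1 - |q|), which is below
  1 for |q| < 1/2.\<close>

lemma f_minus_nonzero_small:
  assumes "norm q < 1 / 2"
  shows "f_minus q \<noteq> 0"
proof -
  have q: "norm q < 1" using assms by simp
  have s: "(\<lambda>k. pcoeff (Suc k) * q ^ Suc k) sums (f_minus q - 1)"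
    using f_minus_sums[OF q] by (subst sums_Suc_iff) (simp add: pcoeff_0)
  have g: "(\<lambda>k. norm q ^ Suc k) sums (norm q * (1 / (1 - norm q)))"
    using sums_mult[OF geometric_sums, of "norm q" "norm q"] q by simp
  have "norm (f_minus q - 1) \<le> norm q * (1 / (1 - norm q))"
  proof (rule norm_sums_le[OF s g])
    show "norm (pcoeff (Suc k) * q ^ Suc k) \<le> norm q ^ Suc k" for k
      unfolding norm_mult norm_power by (intro mult_left_le_one_le norm_pcoeff_le) auto
  qed
  also have "\<dots> < 1" using assms by (simp add: field_simps)
  finally show ?thesis by force
qed

text \<open>The cut at degree 13 is what the final argument requires: a zero of order 13 exceeds by
  one the factor q^12 that clears the poles of F(x, y) F(-x, -y).\<close>

lemma f_minus_expansion:
  "\<exists>h. h holomorphic_on ball 0 1 \<and>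
     (\<forall>q\<in>ball 0 1. f_minus q = 1 - q - q^2 + q^5 + q^7 - q^12 + q ^ 13 * h q)"
proof -
  define h where "h q = (\<Sum>k. pcoeff (k + 13) * q ^ k)" for q
  have sm: "(\<lambda>k. pcoeff (k + 13) * q ^ k) sums h q" if "norm q < 1" for q
  proof -
    have "summable (\<lambda>k. pcoeff (k + 13) * q ^ k)"
      by (rule summable_comparison_test'[where g = "\<lambda>k. norm q ^ k"])
         (use that norm_pcoeff_le in \<open>auto intro!: mult_left_le_one_le simp: norm_mult norm_power summable_geometric\<close>)
    then show ?thesis unfolding h_def by (rule summable_sums)
  qed
  have "h holomorphic_on ball 0 1"
    by (rule power_series_holomorphic[where a = "\<lambda>k. pcoeff (k + 13)"]) (auto intro: sm)
  moreover have "f_minus q = 1 - q - q^2 + q^5 + q^7 - q^12 + q ^ 13 * h q" if "q \<in> ball 0 1" for q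
  proof -
    have q: "norm q < 1" using that by simp
    have "(\<lambda>k. pcoeff (k + 13) * q ^ (k + 13)) sums (q ^ 13 * h q)"
      using sums_mult[OF sm[OF q], of "q ^ 13"] by (simp add: power_add mult_ac)
    then have "(\<lambda>k. pcoeff k * q ^ k) sums (q ^ 13 * h q + (\<Sum>k<13. pcoeff k * q ^ k))"
      by (subst (asm) sums_iff_shift[where f = "\<lambda>k. pcoeff k * q ^ k"]) auto
    then have 1: "f_minus q = q ^ 13 * h q + (\<Sum>k<13. pcoeff k * q ^ k)"
      using sums_unique2 f_minus_sums[OF q] by blast
    have "(\<Sum>k<13. pcoeff k * q ^ k) = (\<Sum>k\<in>pent ` {-2..3}. pcoeff k * q ^ k)"
      by (rule sum.mono_neutral_right) (auto simp: pent_less_13_iff pcoeff_def)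
    also have "\<dots> = (\<Sum>n\<in>{-2..3}. (-1) powi n * q ^ pent n)"
      by (subst sum.reindex) (auto intro: inj_on_subset[OF inj_pent] simp: pcoeff_pent)
    also have "{-2..3} = {-2,-1,0,1,2,3::int}" by force
    finally show ?thesis using 1 by (simp add: pent_def power_int_minus)
  qed
  ultimately show ?thesis by blast
qed

section \<open>Uniqueness of Fourier coefficients and Poisson summation\<close>

text \<open>Induction on n for all k at once: the product formula for cos (2 pi k x) cos (2 pi x)
  expresses the next moment by those at k, k + 1 and k - 1.\<close>

lemma cosine_moment_zero:
  fixes u :: "real \<Rightarrow> real"
  assumes cont: "continuous_on UNIV u"
    and zero: "\<And>k::int. integral {-1/2..1/2} (\<lambda>x. u x * cos (2 * pi * k * x)) = 0"
  shows "integral {-1/2..1/2} (\<lambda>x. u x * cos (2 * pi * of_int k * x) * ((1 + cos (2 * pi * x)) / 2) ^ n) = 0"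
proof (induction n arbitrary: k)
  case 0
  then show ?case using zero[of k] by simp
next
  case (Suc n)
  define g where "g k x = u x * cos (2 * pi * of_int k * x) * ((1 + cos (2 * pi * x)) / 2) ^ n" for k :: int and x
  have int: "g k integrable_on {-1/2..1/2}" for k
    unfolding g_def by (intro integrable_continuous_interval continuous_intros continuous_on_subset[OF cont]) auto
  have "u x * cos (2 * pi * of_int k * x) * ((1 + cos (2 * pi * x)) / 2) ^ Suc n
      = 1/2 * g k x + (1/4 * g (k + 1) x + 1/4 * g (k - 1) x)" for x
  proof -
    have "cos (2 * pi * of_int k * x) * cos (2 * pi * x) =
        (cos (2 * pi * of_int (k + 1) * x) + cos (2 * pi * of_int (k - 1) * x)) / 2"
      by (simp add: algebra_simps cos_add cos_diff)
    moreover have "U * a * ((1 + b) / 2 * W) = 1/2 * (U * a * W) + (1/4 * (U * c * W) + 1/4 * (U * d * W))"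
      if "a * b = (c + d) / 2" for U W a b c d :: real
    proof -
      have "U * a * ((1 + b) / 2 * W) = 1/2 * (U * a * W) + 1/2 * U * W * (a * b)"
        by (simp add: field_simps)
      then show ?thesis unfolding that by (simp add: field_simps)
    qed
    ultimately show ?thesis unfolding g_def power_Suc by blast
  qed
  then have "integral {-1/2..1/2} (\<lambda>x. u x * cos (2 * pi * of_int k * x) * ((1 + cos (2 * pi * x)) / 2) ^ Suc n)
     = integral {-1/2..1/2} (\<lambda>x. 1/2 * g k x + (1/4 * g (k + 1) x + 1/4 * g (k - 1) x))" by (simp only:)
  also have "\<dots> = 1/2 * integral {-1/2..1/2} (g k) +
      (1/4 * integral {-1/2..1/2} (g (k + 1)) + 1/4 * integral {-1/2..1/2} (g (k - 1)))"
    by (subst integral_add integral_mult_right; (intro integrable_add integrable_on_mult_right int)?)+ simp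
  also have "\<dots> = 0" using Suc[of k] Suc[of "k + 1"] Suc[of "k - 1"] unfolding g_def by simp
  finally show ?case .
qed

text \<open>The kernels \<open>((1 + cos 2\<pi>x)/2)\<^sup>n\<close> are cosine polynomials that concentrate at 0.\<close>

lemma cosine_coefficients_zero_imp_nonpos:
  fixes u :: "real \<Rightarrow> real"
  assumes cont: "continuous_on UNIV u"
    and zero: "\<And>k::int. integral {-1/2..1/2} (\<lambda>x. u x * cos (2 * pi * k * x)) = 0"
  shows "u 0 \<le> 0"
proof (rule ccontr)
  assume "\<not> u 0 \<le> 0"
  define \<delta> where "\<delta> = u 0 / 2"
  have \<delta>: "\<delta> > 0" using \<open>\<not> u 0 \<le> 0\<close> by (simp add: \<delta>_def)
  have "isCont u 0" using cont by (simp add: continuous_on_eq_continuous_at)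
  then obtain d where d: "d > 0" "\<And>x. \<bar>x\<bar> < d \<Longrightarrow> \<bar>u x - u 0\<bar> < \<delta>"
    using \<delta> unfolding continuous_at_eps_delta dist_real_def by (metis diff_zero)
  \<comment> \<open>The bound 1/4 makes cos (2 pi r) nonnegative, so \<open>C r\<close> is positive
    and can serve as a denominator.\<close>
  define r where "r = min (d / 2) (1 / 4)"
  have r: "r > 0" "r < d" "r \<le> 1 / 4" using d(1) by (auto simp: r_def)
  have ur: "u x \<ge> \<delta>" if "\<bar>x\<bar> \<le> r" for x
  proof -
    have "\<bar>u x - u 0\<bar> < \<delta>" using d(2)[of x] that r by simp
    then show ?thesis unfolding \<delta>_def by linarith
  qed
  define C where "C x = (1 + cos (2 * pi * x)) / 2" for x :: real
  have C0: "0 \<le> C x" for x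
  proof -
    have "(1 + (- 1)) / 2 \<le> C x"
      unfolding C_def by (intro divide_right_mono add_left_mono cos_ge_minus_one) simp
    then show ?thesis by simp
  qed
  have Cmono: "C y \<le> C x" if "\<bar>x\<bar> \<le> \<bar>y\<bar>" "\<bar>y\<bar> \<le> 1/2" for x y
  proof -
    have "cos (2 * pi * \<bar>y\<bar>) \<le> cos (2 * pi * \<bar>x\<bar>)"
      by (rule cos_monotone_0_pi_le) (use that in auto)
    moreover have "cos (2 * pi * \<bar>z\<bar>) = cos (2 * pi * z)" for z by (cases "z \<ge> 0") auto
    ultimately show ?thesis by (simp add: C_def)
  qed
  have Cless: "C r < C (r / 2)"
    unfolding C_def using cos_monotone_0_pi[of "2 * pi * (r/2)" "2 * pi * r"] r by simp
  have "2 * pi * r \<le> pi / 2" using r by simp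
  then have "cos (2 * pi * r) \<ge> 0" using r by (intro cos_ge_zero) (auto intro: order_trans[of _ 0])
  then have Cr: "C r > 0" by (simp add: C_def)
  have "bounded (u ` {-1/2..1/2})"
    by (intro compact_imp_bounded compact_continuous_image continuous_on_subset[OF cont]) auto
  then obtain B where B: "B > 0" "\<And>x. x \<in> {-1/2..1/2} \<Longrightarrow> \<bar>u x\<bar> \<le> B"
    unfolding bounded_pos by (metis imageI real_norm_def)
  \<comment> \<open>The weighted integral of u is 0. Its part on |x| <= r/2 has at least the size on
    the left, and the negative contributions come only from |x| > r, where the kernel is at most
    \<open>C r ^ n\<close>.\<close>
  have main: "\<delta> * r * C (r / 2) ^ n \<le> B * C r ^ n" for n
  proof -
    \<comment> \<open>The added constant makes the integrand nonnegative, so the integral over the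
      inner interval is at most the whole one.\<close>
    define v where "v x = u x * C x ^ n + B * C r ^ n" for x
    have cv: "continuous_on S v" for S
      unfolding v_def C_def by (intro continuous_intros continuous_on_subset[OF cont]) auto
    have v0: "v x \<ge> 0" if "x \<in> {-1/2..1/2}" for x
    proof (cases "\<bar>x\<bar> \<le> r")
      case True
      then show ?thesis using ur[of x] \<delta> B C0 unfolding v_def by (intro add_nonneg_nonneg mult_nonneg_nonneg zero_le_power) auto
    next
      case False
      have "C x ^ n \<le> C r ^ n" using Cmono[of r x] False that r by (intro power_mono C0) auto
      then have "\<bar>u x\<bar> * C x ^ n \<le> B * C r ^ n" using B that C0 by (intro mult_mono) auto
      moreover have "- (\<bar>u x\<bar> * C x ^ n) \<le> u x * C x ^ n"
        using C0[of x] by (metis abs_ge_minus_self abs_mult abs_of_nonneg minus_le_iff zero_le_power)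
      ultimately show ?thesis unfolding v_def by linarith
    qed
    have "integral {-1/2..1/2} (\<lambda>x. u x * C x ^ n) = 0"
      using cosine_moment_zero[OF cont zero, of 0 n] by (simp add: C_def)
    moreover have "integral {-1/2..1/2} v = integral {-1/2..1/2} (\<lambda>x. u x * C x ^ n) + integral {-1/2..1/2} (\<lambda>x::real. B * C r ^ n)"
      unfolding v_def C_def by (intro integral_add integrable_continuous_interval continuous_intros continuous_on_subset[OF cont]) auto
    ultimately have "integral {-1/2..1/2} v = B * C r ^ n" by simp
    moreover have "integral {-(r/2)..r/2} v \<le> integral {-1/2..1/2} v"
      using r by (intro integral_subset_le integrable_continuous_interval cv) (auto intro!: v0)
    moreover have "integral {-(r/2)..r/2} (\<lambda>x. \<delta> * C (r/2) ^ n) \<le> integral {-(r/2)..r/2} v"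
    proof (intro integral_le integrable_continuous_interval cv continuous_intros)
      fix x assume x: "x \<in> {-(r/2)..r/2}"
      then have *: "\<bar>x\<bar> \<le> r/2" by auto
      have "C (r/2) ^ n \<le> C x ^ n" using * r by (intro power_mono C0 Cmono) auto
      then have "\<delta> * C (r/2) ^ n \<le> u x * C x ^ n" using ur[of x] * r \<delta> C0 by (intro mult_mono) auto
      moreover have "0 \<le> B * C r ^ n" using B(1) C0[of r] by simp
      ultimately show "\<delta> * C (r/2) ^ n \<le> v x" unfolding v_def by linarith
    qed
    moreover have "integral {-(r/2)..r/2} (\<lambda>x::real. \<delta> * C (r/2) ^ n) = \<delta> * r * C (r / 2) ^ n"
      using r(1) by auto
    ultimately show ?thesis by linarith
  qed
  \<comment> \<open>The ratio of the two kernels grows geometrically with n, which contradicts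
    \<open>main\<close> for large n.\<close>
  have "1 < C (r / 2) / C r" using Cless Cr by simp
  then obtain n where "B / (\<delta> * r) < (C (r / 2) / C r) ^ n" using real_arch_pow by blast
  then have "B * C r ^ n < \<delta> * r * C (r / 2) ^ n"
    using \<delta> r Cr by (simp add: power_divide field_simps)
  with main[of n] show False by simp
qed

text \<open>The one-sided bound applied to both u and -u. Cosine coefficients alone determine the
  value at the centre of the interval.\<close>

lemma cosine_coefficients_zero:
  fixes u :: "real \<Rightarrow> real"
  assumes cont: "continuous_on UNIV u"
    and zero: "\<And>k::int. integral {-1/2..1/2} (\<lambda>x. u x * cos (2 * pi * k * x)) = 0"
  shows "u 0 = 0"
proof (rule antisym)
  show "u 0 \<le> 0" by (rule cosine_coefficients_zero_imp_nonpos[OF assms])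
  have "- u 0 \<le> 0"
    by (rule cosine_coefficients_zero_imp_nonpos[where u = "\<lambda>x. - u x"])
       (use zero in \<open>auto intro!: continuous_intros cont\<close>)
  then show "u 0 \<ge> 0" by simp
qed

section \<open>Dominated series: continuity, termwise integration and Gaussian majorants\<close>

text \<open>The Weierstrass M-test gives uniform convergence on compact intervals, which yields both
  continuity and termwise integration.\<close>

lemma continuous_dominated_infsum:
  fixes f :: "'a \<Rightarrow> real \<Rightarrow> real"
  assumes cont: "\<And>n. continuous_on UNIV (f n)"
    and bound: "\<And>R. \<exists>M. M summable_on UNIV \<and> (\<forall>n. \<forall>x. \<bar>x\<bar> \<le> R \<longrightarrow> \<bar>f n x\<bar> \<le> M n)"
  shows "continuous_on UNIV (\<lambda>x. \<Sum>\<^sub>\<infinity>n. f n x)"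
    and "((\<lambda>n. integral {a..b} (f n)) has_sum integral {a..b} (\<lambda>x. \<Sum>\<^sub>\<infinity>n. f n x)) UNIV"
proof -
  have ul: "uniform_limit {a..b} (\<lambda>X x. \<Sum>n\<in>X. f n x) (\<lambda>x. \<Sum>\<^sub>\<infinity>n. f n x) (finite_subsets_at_top UNIV)" for a b
  proof -
    obtain M where M: "M summable_on UNIV" "\<And>n x. \<bar>x\<bar> \<le> max \<bar>a\<bar> \<bar>b\<bar> \<Longrightarrow> \<bar>f n x\<bar> \<le> M n"
      using bound by meson
    show ?thesis
      by (rule Weierstrass_m_test_general[OF _ M(1)]) (auto intro!: M(2))
  qed
  have ct: "continuous_on {a..b} (\<lambda>x. \<Sum>\<^sub>\<infinity>n. f n x)" for a b
    by (rule uniform_limit_theorem[OF _ ul])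
       (auto intro!: always_eventually continuous_intros continuous_on_subset[OF cont])
  show "continuous_on UNIV (\<lambda>x. \<Sum>\<^sub>\<infinity>n. f n x)"
  proof (rule continuous_at_imp_continuous_on, rule ballI)
    fix x :: real
    have "continuous_on {x - 1<..<x + 1} (\<lambda>x. \<Sum>\<^sub>\<infinity>n. f n x)"
      by (rule continuous_on_subset[OF ct[of "x - 1" "x + 1"]]) auto
    then show "isCont (\<lambda>x. \<Sum>\<^sub>\<infinity>n. f n x) x"
      by (simp add: continuous_on_eq_continuous_at)
  qed
  obtain I J where I: "\<And>X. ((\<lambda>x. \<Sum>n\<in>X. f n x) has_integral I X) {a..b}"
    and J: "((\<lambda>x. \<Sum>\<^sub>\<infinity>n. f n x) has_integral J) {a..b}"
    and lim: "(I \<longlongrightarrow> J) (finite_subsets_at_top UNIV)"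
    by (rule uniform_limit_integral[OF ul])
       (auto intro!: continuous_intros continuous_on_subset[OF cont])
  have "eventually (\<lambda>X. I X = (\<Sum>n\<in>X. integral {a..b} (f n))) (finite_subsets_at_top UNIV)"
  proof (rule eventually_finite_subsets_at_top_weakI)
    fix X :: "'a set" assume "finite X"
    then have "integral {a..b} (\<lambda>x. \<Sum>n\<in>X. f n x) = (\<Sum>n\<in>X. integral {a..b} (f n))"
      by (intro integral_sum integrable_continuous_interval continuous_on_subset[OF cont]) auto
    then show "I X = (\<Sum>n\<in>X. integral {a..b} (f n))" using I[of X] by (simp add: integral_unique)
  qed
  then have "((\<lambda>X. \<Sum>n\<in>X. integral {a..b} (f n)) \<longlongrightarrow> J) (finite_subsets_at_top UNIV)"
    by (rule Lim_transform_eventually[OF lim])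
  then show "((\<lambda>n. integral {a..b} (f n)) has_sum integral {a..b} (\<lambda>x. \<Sum>\<^sub>\<infinity>n. f n x)) UNIV"
    using J by (simp add: has_sum_def integral_unique)
qed

lemma summable_on_int_geometric:
  fixes r :: real
  assumes "0 \<le> r" "r < 1"
  shows "(\<lambda>n::int. r ^ nat \<bar>n\<bar>) summable_on UNIV"
proof -
  have g: "(\<lambda>n. r ^ n) summable_on UNIV"
    using assms by (intro norm_summable_imp_summable_on) (simp add: norm_power summable_geometric)
  have 1: "(\<lambda>n::int. r ^ nat \<bar>n\<bar>) summable_on range int"
    by (subst summable_on_reindex) (auto simp: o_def g)
  have 2: "(\<lambda>n::int. r ^ nat \<bar>n\<bar>) summable_on range (\<lambda>n. - int n)"
    by (subst summable_on_reindex) (auto simp: o_def g inj_def)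
  have "UNIV = range int \<union> range (\<lambda>n. - int n)"
    using int_cases2 by blast
  then show ?thesis using summable_on_union[OF 1 2] by simp
qed

text \<open>Since (2 x + n)^2 >= 0, n^2 / 2 <= (x + n)^2 + x^2; with |n| <= n^2 this yields a
  geometric majorant in |n|, uniform for |x| <= R.\<close>

lemma exp_square_bound:
  fixes s x R :: real and n :: int
  assumes "s > 0" "\<bar>x\<bar> \<le> R"
  shows "exp (- (pi * s * (x + n)\<^sup>2)) \<le> exp (pi * s * R\<^sup>2) * exp (- (pi * s / 2)) ^ nat \<bar>n\<bar>"
proof -
  have "real_of_int \<bar>n\<bar> \<le> real_of_int (n\<^sup>2)"
  proof (cases "n = 0")
    case False
    then have "\<bar>n\<bar> * 1 \<le> \<bar>n\<bar> * \<bar>n\<bar>" by (intro mult_left_mono) auto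
    then show ?thesis by (simp add: power2_eq_square flip: of_int_mult)
  qed simp
  moreover have "(real_of_int n)\<^sup>2 / 2 \<le> (x + n)\<^sup>2 + x\<^sup>2"
    using zero_le_power2[of "2 * x + n"] by (simp add: power2_eq_square algebra_simps)
  moreover have "x\<^sup>2 \<le> R\<^sup>2" using assms by (metis abs_ge_zero power2_abs power_mono)
  ultimately have "real_of_int \<bar>n\<bar> / 2 - R\<^sup>2 \<le> (x + n)\<^sup>2" by simp
  then have "pi * s * (real_of_int \<bar>n\<bar> / 2 - R\<^sup>2) \<le> pi * s * (x + n)\<^sup>2"
    using assms by (intro mult_left_mono) auto
  then show ?thesis
    by (simp add: exp_of_nat_mult[symmetric] exp_add[symmetric] algebra_simps)
qed

section \<open>Fourier transform of the Gaussian and Poisson summation\<close>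

text \<open>This is the characteristic function of the standard normal distribution after the
  substitution c x0 + c x. The factor iexp (-2 pi k x0) removes the phase of the shift, and the real
  part gives the cosine.\<close>

lemma has_bochner_integral_gaussian_cos:
  fixes s x0 k :: real
  assumes s: "s > 0"
  shows "has_bochner_integral lborel (\<lambda>x. exp (- (pi * s * (x0 + x)\<^sup>2)) * cos (2 * pi * k * x))
     (exp (- (pi * k\<^sup>2 / s)) * cos (2 * pi * k * x0) / sqrt s)"
proof -
  define c where "c = sqrt (2 * pi * s)"
  have c: "c > 0" "c\<^sup>2 = 2 * pi * s" "c \<noteq> 0" using s by (auto simp: c_def)
  define t where "t = 2 * pi * k / c"
  have std: "has_bochner_integral lborel (\<lambda>x. std_normal_density x *\<^sub>R iexp (t * x)) (complex_of_real (exp (- (t^2) / 2)))"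
  proof -
    have I: "complex_integrable std_normal_distribution (\<lambda>x. iexp (t * x))"
    proof -
      interpret real_distribution std_normal_distribution
        by (rule real_dist_normal_dist)
      show ?thesis by (rule integrable_const_bound[where B = 1]) auto
    qed
    have "(CLINT x|std_normal_distribution. iexp (t * x)) = complex_of_real (exp (- (t^2) / 2))"
      using char_std_normal_distribution by (simp add: char_def fun_eq_iff)
    then show ?thesis
      using I by (subst (asm) integrable_density, simp, simp, simp add: normal_density_nonneg,
          subst (asm) integral_density) (simp_all add: normal_density_nonneg has_bochner_integral_iff)
  qed
  have "has_bochner_integral lborel
      (\<lambda>x. std_normal_density (c * x0 + c * x) *\<^sub>R iexp (t * (c * x0 + c * x)))
      (complex_of_real (exp (- (t^2) / 2)) /\<^sub>R \<bar>c\<bar>)"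
    using std c by (subst (asm) lborel_has_bochner_integral_real_affine_iff[where c = c and t = "c * x0"]) auto
  then have "has_bochner_integral lborel
      (\<lambda>x. (sqrt (2 * pi) * iexp (- (2 * pi * k * x0))) * (std_normal_density (c * x0 + c * x) *\<^sub>R iexp (t * (c * x0 + c * x))))
      ((sqrt (2 * pi) * iexp (- (2 * pi * k * x0))) * (complex_of_real (exp (- (t^2) / 2)) /\<^sub>R \<bar>c\<bar>))"
    by (rule has_bochner_integral_mult_right)
  then have "has_bochner_integral lborel
      (\<lambda>x. Re ((sqrt (2 * pi) * iexp (- (2 * pi * k * x0))) * (std_normal_density (c * x0 + c * x) *\<^sub>R iexp (t * (c * x0 + c * x)))))
      (Re ((sqrt (2 * pi) * iexp (- (2 * pi * k * x0))) * (complex_of_real (exp (- (t^2) / 2)) /\<^sub>R \<bar>c\<bar>)))"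
    by (rule has_bochner_integral_bounded_linear[OF bounded_linear_Re])
  also have "(\<lambda>x. Re ((sqrt (2 * pi) * iexp (- (2 * pi * k * x0))) * (std_normal_density (c * x0 + c * x) *\<^sub>R iexp (t * (c * x0 + c * x)))))
     = (\<lambda>x. exp (- (pi * s * (x0 + x)\<^sup>2)) * cos (2 * pi * k * x))"
  proof
    fix x
    have "iexp (- (2 * pi * k * x0)) * iexp (t * (c * x0 + c * x)) = iexp (2 * pi * k * x)"
    proof -
      have "t * (c * x0 + c * x) = 2 * pi * k * x0 + 2 * pi * k * x"
        using c by (simp add: t_def field_simps)
      then show ?thesis by (simp add: exp_add[symmetric] algebra_simps)
    qed
    moreover have "sqrt (2 * pi) * std_normal_density (c * x0 + c * x) = exp (- (pi * s * (x0 + x)\<^sup>2))"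
    proof -
      have "(c * x0 + c * x)\<^sup>2 = 2 * pi * s * (x0 + x)\<^sup>2"
        unfolding distrib_left[symmetric] power_mult_distrib c(2) ..
      then show ?thesis by (simp add: normal_density_def)
    qed
    moreover have "(sqrt (2 * pi) * iexp (- (2 * pi * k * x0))) * (std_normal_density (c * x0 + c * x) *\<^sub>R iexp (t * (c * x0 + c * x)))
      = of_real (sqrt (2 * pi) * std_normal_density (c * x0 + c * x)) * (iexp (- (2 * pi * k * x0)) * iexp (t * (c * x0 + c * x)))"
      by (simp only: scaleR_conv_of_real of_real_mult mult_ac)
    ultimately have "(sqrt (2 * pi) * iexp (- (2 * pi * k * x0))) * (std_normal_density (c * x0 + c * x) *\<^sub>R iexp (t * (c * x0 + c * x)))
      = of_real (exp (- (pi * s * (x0 + x)\<^sup>2))) * iexp (2 * pi * k * x)"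
      by (simp only:)
    then show "Re ((sqrt (2 * pi) * iexp (- (2 * pi * k * x0))) * (std_normal_density (c * x0 + c * x) *\<^sub>R iexp (t * (c * x0 + c * x))))
      = exp (- (pi * s * (x0 + x)\<^sup>2)) * cos (2 * pi * k * x)"
      by (simp only:) (simp add: Re_exp)
  qed
  also have "Re ((sqrt (2 * pi) * iexp (- (2 * pi * k * x0))) * (complex_of_real (exp (- (t^2) / 2)) /\<^sub>R \<bar>c\<bar>))
     = exp (- (pi * k\<^sup>2 / s)) * cos (2 * pi * k * x0) / sqrt s"
  proof -
    have "t\<^sup>2 / 2 = pi * k\<^sup>2 / s"
      using c s by (simp add: t_def power_divide power_mult_distrib field_simps) (simp add: power2_eq_square)
    moreover have "sqrt (2 * pi) / c = 1 / sqrt s" using s by (simp add: c_def real_sqrt_mult)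
    ultimately show ?thesis using c(1) by (simp add: scaleR_conv_of_real Re_exp field_simps)
  qed
  finally show ?thesis .
qed

lemma filterlim_symmetric_intervals:
  "filterlim (\<lambda>N::nat. {-int N..int N}) (finite_subsets_at_top UNIV) sequentially"
  unfolding filterlim_finite_subsets_at_top
proof (intro allI impI)
  fix X :: "int set" assume "finite X \<and> X \<subseteq> UNIV"
  then have "finite (nat ` abs ` X)" by simp
  then obtain K where K: "\<And>x. x \<in> X \<Longrightarrow> nat \<bar>x\<bar> \<le> K"
    by (metis finite_nat_set_iff_bounded_le imageI)
  show "\<forall>\<^sub>F N in sequentially. finite {- int N..int N} \<and> X \<subseteq> {- int N..int N} \<and> {- int N..int N} \<subseteq> UNIV"
  proof (rule eventually_sequentiallyI[of K])
    fix N assume "K \<le> N"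
    then have "\<bar>x\<bar> \<le> int N" if "x \<in> X" for x using K[OF that] by linarith
    then show "finite {- int N..int N} \<and> X \<subseteq> {- int N..int N} \<and> {- int N..int N} \<subseteq> UNIV"
      by (auto simp: abs_le_iff minus_le_iff)
  qed
qed

text \<open>Unit intervals centred at the integers tile the line: the sum over |n| <= N is the
  integral over [-(N + 1/2), N + 1/2], which tends to the integral over the line.\<close>

lemma has_sum_unit_interval_integrals:
  fixes h :: "real \<Rightarrow> real"
  assumes cont: "continuous_on UNIV h" and I: "has_bochner_integral lborel h I"
    and sum: "((\<lambda>n::int. integral {-1/2..1/2} (\<lambda>x. h (x + of_int n))) has_sum S) UNIV"
  shows "S = I"
proof -
  have int: "h integrable_on {a..b}" for a b
    by (intro integrable_continuous_interval continuous_on_subset[OF cont]) auto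
  have sh: "integral {-1/2..1/2} (\<lambda>x. h (x + c)) = integral {c - 1/2..c + 1/2} h" for c
    using integral_shift_Icc_real[of "-1/2" "1/2" h c] by (simp add: o_def add.commute)
  have fin: "(\<Sum>n\<in>{-int N..int N}. integral {-1/2..1/2} (\<lambda>x. h (x + of_int n)))
     = integral {-(N + 1/2)..N + 1/2} h" for N :: nat
  proof (induction N)
    case 0
    then show ?case by (simp add: sh)
  next
    case (Suc N)
    have "{-int (Suc N)..int (Suc N)} = insert (- int (Suc N)) (insert (int (Suc N)) {-int N..int N})"
      by auto
    moreover have "integral {-1/2..1/2} (\<lambda>x. h (x + of_int (int (Suc N)))) = integral {real N + 1/2..real N + 3/2} h"
    proof -
      have "real (Suc N) - 1/2 = real N + 1/2" "real (Suc N) + 1/2 = real N + 3/2" by simp_all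
      then show ?thesis by (simp only: sh of_int_of_nat_eq)
    qed
    moreover have "integral {-1/2..1/2} (\<lambda>x. h (x + of_int (- int (Suc N)))) = integral {-(real N + 3/2)..-(real N + 1/2)} h"
    proof -
      have "- real (Suc N) - 1/2 = -(real N + 3/2)" "- real (Suc N) + 1/2 = -(real N + 1/2)" by simp_all
      then show ?thesis by (simp only: sh of_int_of_nat_eq of_int_minus)
    qed
    ultimately have "(\<Sum>n\<in>{-int (Suc N)..int (Suc N)}. integral {-1/2..1/2} (\<lambda>x. h (x + of_int n)))
        = integral {-(real N + 3/2)..-(real N + 1/2)} h +
          (integral {-(real N + 1/2)..real N + 1/2} h + integral {real N + 1/2..real N + 3/2} h)"
      using Suc by (simp del: of_nat_Suc of_int_minus of_int_of_nat_eq)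
    also have "integral {-(real N + 1/2)..real N + 1/2} h + integral {real N + 1/2..real N + 3/2} h
       = integral {-(real N + 1/2)..real N + 3/2} h"
      by (intro Henstock_Kurzweil_Integration.integral_combine int) auto
    also have "integral {-(real N + 3/2)..-(real N + 1/2)} h + integral {-(real N + 1/2)..real N + 3/2} h
       = integral {-(real N + 3/2)..real N + 3/2} h"
      by (intro Henstock_Kurzweil_Integration.integral_combine int) auto
    finally show ?case by (simp add: algebra_simps)
  qed
  have lim1: "(\<lambda>N. integral {-(real N + 1/2)..real N + 1/2} h) \<longlonglongrightarrow> S"
    unfolding fin[symmetric]
    using filterlim_compose[OF sum[unfolded has_sum_def] filterlim_symmetric_intervals] by simp
  have hI: "(h has_integral I) UNIV"
    using I has_integral_integral_lborel[of h] by (metis has_bochner_integral_iff)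
  have lim2: "(\<lambda>N. integral {-(real N + 1/2)..real N + 1/2} h) \<longlonglongrightarrow> I"
  proof (rule LIMSEQ_I)
    fix e :: real assume "e > 0"
    then obtain B where B: "B > 0" "\<And>a b. ball 0 B \<subseteq> cbox a b \<Longrightarrow>
        \<exists>z. ((\<lambda>x. if x \<in> UNIV then h x else 0) has_integral z) (cbox a b) \<and> norm (z - I) < e"
      using has_integral_altD[OF hI] by (metis not_bounded_UNIV bounded_cbox)
    obtain K :: nat where K: "B \<le> real K" using real_arch_simple by blast
    have "norm (integral {-(real N + 1/2)..real N + 1/2} h - I) < e" if "N \<ge> K" for N
    proof -
      have "ball 0 B \<subseteq> cbox (-(real N + 1/2)) (real N + 1/2)"
        using K that by (auto simp: dist_real_def abs_less_iff)
      from B(2)[OF this] show ?thesis by (auto dest: integral_unique)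
    qed
    then show "\<exists>no. \<forall>n\<ge>no. norm (integral {-(real n + 1/2)..real n + 1/2} h - I) < e" by blast
  qed
  show ?thesis by (rule LIMSEQ_unique[OF lim1 lim2])
qed

lemma integral_cos_unit_interval:
  "integral {-1/2..1/2} (\<lambda>x. cos (a + 2 * pi * of_int m * x)) = (if m = 0 then cos a else 0)"
proof (cases "m = 0")
  case False
  have "((\<lambda>x. cos (a + 2 * pi * of_int m * x)) has_integral
      sin (a + 2 * pi * of_int m * (1/2)) / (2 * pi * m) - sin (a + 2 * pi * of_int m * (-1/2)) / (2 * pi * m)) {-1/2..1/2}"
    using False by (intro fundamental_theorem_of_calculus)
      (auto intro!: derivative_eq_intros simp flip: has_real_derivative_iff_has_vector_derivative)
  moreover have "sin (a + pi * m) = sin (a - pi * m)"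
    using sin_add[of a "pi * m"] sin_diff[of a "pi * m"] by (simp add: sin_times_pi_eq_0 mult.commute)
  ultimately show ?thesis using False by (simp add: integral_unique)
qed simp

text \<open>With x0 replaced by x0 + x, both sides are continuous in x and have the same cosine
  coefficients on the unit interval, so their difference vanishes at x = 0.\<close>

theorem poisson_gaussian:
  fixes s x0 :: real
  assumes s: "s > 0"
  shows "(\<Sum>\<^sub>\<infinity>n::int. exp (- (pi * s * (x0 + n)\<^sup>2))) =
         (\<Sum>\<^sub>\<infinity>k::int. exp (- (pi * k\<^sup>2 / s)) * cos (2 * pi * k * x0) / sqrt s)"
proof -
  define f where "f n x = exp (- (pi * s * (x0 + x + of_int n)\<^sup>2))" for n :: int and x :: real
  define e where "e k = exp (- (pi * (of_int k)\<^sup>2 / s)) / sqrt s" for k :: int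
  define g where "g k x = e k * cos (2 * pi * of_int k * (x0 + x))" for k :: int and x :: real
  have contf: "continuous_on UNIV (\<lambda>x. f n x)" and contg: "continuous_on UNIV (\<lambda>x. g n x)" for n
    unfolding f_def g_def by (intro continuous_intros)+
  have e0: "e k \<ge> 0" for k unfolding e_def using s by simp
  have fb: "\<exists>M. M summable_on UNIV \<and> (\<forall>n. \<forall>x. \<bar>x\<bar> \<le> R \<longrightarrow> \<bar>f n x\<bar> \<le> M n)" for R
  proof (intro exI conjI allI impI)
    show "(\<lambda>n::int. exp (pi * s * (\<bar>x0\<bar> + R)\<^sup>2) * exp (- (pi * s / 2)) ^ nat \<bar>n\<bar>) summable_on UNIV"
      using s by (intro summable_on_cmult_right summable_on_int_geometric) auto
    show "\<bar>f n x\<bar> \<le> exp (pi * s * (\<bar>x0\<bar> + R)\<^sup>2) * exp (- (pi * s / 2)) ^ nat \<bar>n\<bar>" if "\<bar>x\<bar> \<le> R" for n x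
      unfolding f_def using exp_square_bound[OF s, of "x0 + x" "\<bar>x0\<bar> + R" n] that by simp
  qed
  have es: "e summable_on UNIV"
  proof (rule summable_on_comparison_test)
    show "(\<lambda>n::int. exp (- (pi * (1 / s) / 2)) ^ nat \<bar>n\<bar> * (1 / sqrt s)) summable_on UNIV"
      using s by (intro summable_on_cmult_left summable_on_int_geometric) auto
    show "e n \<le> exp (- (pi * (1 / s) / 2)) ^ nat \<bar>n\<bar> * (1 / sqrt s)" for n
      unfolding e_def using exp_square_bound[of "1 / s" 0 0 n] s by (simp add: divide_right_mono)
  qed (use e0 in auto)
  have gb: "\<exists>M. M summable_on UNIV \<and> (\<forall>n. \<forall>x. \<bar>x\<bar> \<le> R \<longrightarrow> \<bar>g n x\<bar> \<le> M n)" for R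
    by (rule exI[of _ e]) (use es e0 in \<open>auto simp: g_def abs_mult intro!: mult_left_le\<close>)
  have wc: "\<exists>M. M summable_on UNIV \<and> (\<forall>n. \<forall>x. \<bar>x\<bar> \<le> R \<longrightarrow> \<bar>F n x * cos (c * x)\<bar> \<le> M n)"
    if "\<exists>M. M summable_on UNIV \<and> (\<forall>n. \<forall>x. \<bar>x\<bar> \<le> R \<longrightarrow> \<bar>F n x\<bar> \<le> M n)"
    for F :: "int \<Rightarrow> real \<Rightarrow> real" and R c
  proof -
    have "\<bar>F n x * cos (c * x)\<bar> \<le> \<bar>F n x\<bar>" for n x by (auto simp: abs_mult intro!: mult_left_le)
    then show ?thesis using that by (meson order_trans)
  qed
  define u where "u x = (\<Sum>\<^sub>\<infinity>n. f n x) - (\<Sum>\<^sub>\<infinity>k. g k x)" for x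
  have cu: "continuous_on UNIV (\<lambda>x. \<Sum>\<^sub>\<infinity>n. f n x)" "continuous_on UNIV (\<lambda>x. \<Sum>\<^sub>\<infinity>k. g k x)"
    by (intro continuous_dominated_infsum(1) contf contg fb gb)+
  \<comment> \<open>As the cosine has period 1, summing the translates over a unit interval unfolds
    to a Gaussian integral over the line.\<close>
  have If: "integral {-1/2..1/2} (\<lambda>x. (\<Sum>\<^sub>\<infinity>n. f n x) * cos (2 * pi * of_int k * x)) = e k * cos (2 * pi * k * x0)" for k :: int
  proof -
    define h where "h x = exp (- (pi * s * (x0 + x)\<^sup>2)) * cos (2 * pi * k * x)" for x
    have "((\<lambda>n. integral {-1/2..1/2} (\<lambda>x. f n x * cos (2 * pi * of_int k * x))) has_sum
        integral {-1/2..1/2} (\<lambda>x. \<Sum>\<^sub>\<infinity>n. f n x * cos (2 * pi * of_int k * x))) UNIV"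
      by (intro continuous_dominated_infsum(2) continuous_intros contf wc fb)
    moreover have "f n x * cos (2 * pi * of_int k * x) = h (x + of_int n)" for n x
    proof -
      have "2 * pi * k * (x + n) = 2 * pi * k * x + 2 * pi * of_int (k * n)" by (simp add: algebra_simps)
      then have "cos (2 * pi * k * (x + n)) = cos (2 * pi * k * x)"
        by (simp only: cos_add cos_int_2pin sin_int_2pin)
      then show ?thesis by (simp add: f_def h_def add.assoc)
    qed
    ultimately have "((\<lambda>n. integral {-1/2..1/2} (\<lambda>x. h (x + of_int n))) has_sum
        integral {-1/2..1/2} (\<lambda>x. \<Sum>\<^sub>\<infinity>n. f n x * cos (2 * pi * of_int k * x))) UNIV"
      by (simp only:)
    moreover have "has_bochner_integral lborel h (e k * cos (2 * pi * k * x0))"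
      using has_bochner_integral_gaussian_cos[OF s, of x0 k] by (simp add: h_def[abs_def] e_def)
    moreover have "continuous_on UNIV h" unfolding h_def[abs_def] by (intro continuous_intros)
    ultimately have "integral {-1/2..1/2} (\<lambda>x. \<Sum>\<^sub>\<infinity>n. f n x * cos (2 * pi * of_int k * x)) = e k * cos (2 * pi * k * x0)"
      using has_sum_unit_interval_integrals by blast
    then show ?thesis by (simp add: infsum_cmult_left')
  qed
  have Ig: "integral {-1/2..1/2} (\<lambda>x. (\<Sum>\<^sub>\<infinity>n. g n x) * cos (2 * pi * of_int k * x)) = e k * cos (2 * pi * k * x0)" for k :: int
  proof -
    \<comment> \<open>By orthogonality only j = k and j = -k survive, each with weight one half; for
      k = 0 they coincide and the two halves still make the full term.\<close>
    define c where "c j = e j * cos (2 * pi * of_int j * x0) / 2" for j :: int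
    have "((\<lambda>n. integral {-1/2..1/2} (\<lambda>x. g n x * cos (2 * pi * of_int k * x))) has_sum
        integral {-1/2..1/2} (\<lambda>x. \<Sum>\<^sub>\<infinity>n. g n x * cos (2 * pi * of_int k * x))) UNIV"
      by (intro continuous_dominated_infsum(2) continuous_intros contg wc gb)
    moreover have "integral {-1/2..1/2} (\<lambda>x. g j x * cos (2 * pi * of_int k * x))
       = (if j = - k then c j else 0) + (if j = k then c j else 0)" for j
    proof -
      have "g j x * cos (2 * pi * of_int k * x) =
         e j / 2 * (cos (2 * pi * j * x0 + 2 * pi * of_int (j + k) * x) + cos (2 * pi * j * x0 + 2 * pi * of_int (j - k) * x))" for x
        unfolding g_def mult.assoc cos_times_cos by (simp add: algebra_simps)
      then have "integral {-1/2..1/2} (\<lambda>x. g j x * cos (2 * pi * of_int k * x)) =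
         e j / 2 * (integral {-1/2..1/2} (\<lambda>x. cos (2 * pi * j * x0 + 2 * pi * of_int (j + k) * x))
           + integral {-1/2..1/2} (\<lambda>x. cos (2 * pi * j * x0 + 2 * pi * of_int (j - k) * x)))"
        by (simp only: integral_mult_right)
           (subst integral_add; (intro integrable_continuous_interval continuous_intros)?; simp)
      also have "\<dots> = (if j = - k then c j else 0) + (if j = k then c j else 0)"
        unfolding integral_cos_unit_interval by (auto simp: c_def eq_neg_iff_add_eq_0)
      finally show ?thesis .
    qed
    moreover have "((\<lambda>j. (if j = - k then c j else 0) + (if j = k then c j else 0)) has_sum c (-k) + c k) UNIV"
      by (intro has_sum_add; rule has_sum_finite_neutralI[where B = "{- k}"] has_sum_finite_neutralI[where B = "{k}"]) auto
    ultimately have "integral {-1/2..1/2} (\<lambda>x. \<Sum>\<^sub>\<infinity>n. g n x * cos (2 * pi * of_int k * x)) = c (-k) + c k"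
      using has_sum_unique by fastforce
    then show ?thesis by (simp add: infsum_cmult_left' c_def e_def)
  qed
  have "u 0 = 0"
  proof (rule cosine_coefficients_zero)
    show "continuous_on UNIV u" unfolding u_def by (intro continuous_intros cu)
    fix k :: int
    have "integral {-1/2..1/2} (\<lambda>x. u x * cos (2 * pi * k * x)) =
       integral {-1/2..1/2} (\<lambda>x. (\<Sum>\<^sub>\<infinity>n. f n x) * cos (2 * pi * k * x)) - integral {-1/2..1/2} (\<lambda>x. (\<Sum>\<^sub>\<infinity>n. g n x) * cos (2 * pi * k * x))"
      unfolding u_def left_diff_distrib
      by (intro integral_diff integrable_continuous_interval continuous_intros continuous_on_subset[OF cu(1)] continuous_on_subset[OF cu(2)]) auto
    then show "integral {-1/2..1/2} (\<lambda>x. u x * cos (2 * pi * k * x)) = 0" using If Ig by simp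
  qed
  then show ?thesis by (simp add: u_def f_def g_def e_def)
qed

section \<open>The square of the eta function\<close>

lemma summable_gaussian:
  fixes s x :: real and c :: "int \<Rightarrow> real"
  assumes s: "s > 0" and c: "\<And>n. \<bar>c n\<bar> \<le> 1"
  shows "(\<lambda>n::int. c n * exp (- (pi * s * (x + n)\<^sup>2))) summable_on UNIV"
proof (subst summable_on_iff_abs_summable_on_real, rule Infinite_Sum.abs_summable_on_comparison_test')
  show "(\<lambda>n::int. exp (pi * s * \<bar>x\<bar>\<^sup>2) * exp (- (pi * s / 2)) ^ nat \<bar>n\<bar>) summable_on UNIV"
    using s by (intro summable_on_cmult_right summable_on_int_geometric) auto
  show "norm (c n * exp (- (pi * s * (x + n)\<^sup>2))) \<le> exp (pi * s * \<bar>x\<bar>\<^sup>2) * exp (- (pi * s / 2)) ^ nat \<bar>n\<bar>" for n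
  proof -
    have "norm (c n * exp (- (pi * s * (x + n)\<^sup>2))) \<le> 1 * exp (- (pi * s * (x + n)\<^sup>2))"
      unfolding norm_mult using c[of n] by (intro mult_mono) auto
    also have "\<dots> \<le> exp (pi * s * \<bar>x\<bar>\<^sup>2) * exp (- (pi * s / 2)) ^ nat \<bar>n\<bar>"
      using exp_square_bound[OF s order_refl, of x n] by simp
    finally show ?thesis .
  qed
qed

text \<open>The value of the Dedekind eta function at i t, by completing the square: n (3 n - 1) / 2
  + 1/24 = (3/2) (n - 1/6)^2.\<close>

definition eta_series :: "real \<Rightarrow> real" where
  "eta_series t = (\<Sum>\<^sub>\<infinity>n::int. (-1) powi n * exp (- (pi * (3 * t) * (- 1 / 6 + n)\<^sup>2)))"

lemma cos_pi_int: "cos (pi * of_int n) = (-1) powi n"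
  by (cases "even n") (auto simp: cos_int_times_real power_int_minus_left elim!: evenE oddE)

text \<open>The shifts -1/12 and 5/12 differ by 1/2, so the second cosine is the first one times cos
  (pi k).\<close>

lemma cos_twelfth_difference:
  fixes k :: int
  shows "cos (2 * pi * k * (- 1 / 12)) - cos (2 * pi * k * (5 / 12)) = cos (pi * k / 6) * (1 - cos (pi * k))"
proof -
  have "2 * pi * k * (5 / 12) = pi * k - pi * k / 6" by simp
  then have "cos (2 * pi * k * (5 / 12)) = cos (pi * k) * cos (pi * k / 6)"
    by (simp only: cos_diff) (simp add: sin_times_pi_eq_0 mult.commute)
  then show ?thesis by (simp add: algebra_simps)
qed

lemma cos_twelfth_at:
  fixes n :: int
  shows "cos (pi * of_int (6 * n - 1) / 6) * (1 - cos (pi * of_int (6 * n - 1))) = sqrt 3 * (-1) powi n"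
proof -
  have "pi * of_int (6 * n - 1) / 6 = pi * n - pi / 6" by (simp add: field_simps)
  then have "cos (pi * of_int (6 * n - 1) / 6) = (-1) powi n * (sqrt 3 / 2)"
    by (simp only: cos_diff cos_pi_int) (simp add: sin_times_pi_eq_0 mult.commute cos_30)
  moreover have "cos (pi * of_int (6 * n - 1)) = -1"
    unfolding cos_pi_int by (simp add: power_int_minus_left)
  ultimately show ?thesis by simp
qed

text \<open>Even k annihilate the second factor; the remaining odd k are 3 modulo 6 and annihilate
  the first.\<close>

lemma cos_twelfth_zero:
  fixes k :: int
  assumes "k \<notin> range (\<lambda>n. 6 * n - 1)" "k \<notin> range (\<lambda>n. 1 - 6 * n)"
  shows "cos (pi * of_int k / 6) * (1 - cos (pi * of_int k)) = 0"
proof (cases "even k")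
  case True
  then show ?thesis unfolding cos_pi_int by (simp add: power_int_minus_left)
next
  case False
  have "k \<noteq> 6 * n - 1" "k \<noteq> 1 - 6 * n" for n using assms by auto
  then have "\<exists>m. k = 6 * m + 3" using False by presburger
  then obtain m where m: "k = 6 * m + 3" ..
  have "pi * of_int k / 6 = pi * m + pi / 2" by (simp add: m field_simps)
  then have "cos (pi * of_int k / 6) = 0"
    by (simp only: cos_add) (simp add: sin_times_pi_eq_0 mult.commute)
  then show ?thesis by simp
qed

text \<open>For n = 2 m and n = 2 m + 1 the shifted index is 2 (m - 1/12) and 2 (m + 5/12); the
  square of the factor 2 turns 3 t into 12 t.\<close>

lemma eta_series_split:
  assumes t: "t > 0"
  shows "eta_series t = (\<Sum>\<^sub>\<infinity>n::int. exp (- (pi * (12 * t) * (- 1 / 12 + n)\<^sup>2)))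
                     - (\<Sum>\<^sub>\<infinity>n::int. exp (- (pi * (12 * t) * (5 / 12 + n)\<^sup>2)))"
proof -
  define f where "f n = (-1) powi n * exp (- (pi * (3 * t) * (- 1 / 6 + of_int n)\<^sup>2))" for n :: int
  have "f summable_on UNIV"
    unfolding f_def using summable_gaussian[of "3 * t" "\<lambda>n. (-1) powi n" "- 1 / 6"] t by simp
  then have s: "f summable_on A" for A
    by (rule summable_on_subset_banach) simp
  have "(UNIV :: int set) = range (\<lambda>n. 2 * n) \<union> range (\<lambda>n. 2 * n + 1)"
  proof -
    have "k \<in> range (\<lambda>n. 2 * n) \<union> range (\<lambda>n. 2 * n + 1)" for k :: int
      by (cases "even k") (auto elim!: evenE oddE)
    then show ?thesis by blast
  qed
  moreover have "range (\<lambda>n::int. 2 * n) \<inter> range (\<lambda>n. 2 * n + 1) = {}" by (auto, presburger)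
  ultimately have "eta_series t = infsum f (range (\<lambda>n. 2 * n)) + infsum f (range (\<lambda>n. 2 * n + 1))"
    unfolding eta_series_def f_def[symmetric] using s by (metis infsum_Un_disjoint)
  also have "infsum f (range (\<lambda>n. 2 * n)) = (\<Sum>\<^sub>\<infinity>n::int. exp (- (pi * (12 * t) * (- 1 / 12 + n)\<^sup>2)))"
  proof -
    have "f (2 * n) = exp (- (pi * (12 * t) * (- 1 / 12 + real_of_int n)\<^sup>2))" for n
    proof -
      have *: "- 1 / 6 + real_of_int (2 * n) = 2 * (- 1 / 12 + real_of_int n)" by simp
      show ?thesis unfolding f_def * power_mult_distrib by (simp add: power_int_minus_left)
    qed
    then show ?thesis by (subst infsum_reindex) (auto simp: inj_def o_def)
  qed
  also have "infsum f (range (\<lambda>n. 2 * n + 1)) = (\<Sum>\<^sub>\<infinity>n::int. - exp (- (pi * (12 * t) * (5 / 12 + n)\<^sup>2)))"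
  proof -
    have "f (2 * n + 1) = - exp (- (pi * (12 * t) * (5 / 12 + real_of_int n)\<^sup>2))" for n
    proof -
      have *: "- 1 / 6 + real_of_int (2 * n + 1) = 2 * (5 / 12 + real_of_int n)" by simp
      show ?thesis unfolding f_def * power_mult_distrib by (simp add: power_int_minus_left)
    qed
    then show ?thesis by (subst infsum_reindex) (auto simp: inj_def o_def)
  qed
  finally show ?thesis by (simp add: infsum_uminus)
qed

text \<open>Splitting by the parity of \<open>n\<close> absorbs the sign \<open>(-1)\<^sup>n\<close> into two shifted Gaussian sums; after Poisson
  summation only the frequencies \<open>k \<equiv> \<plusminus>1\<close> modulo 6 survive.\<close>

lemma eta_series_inversion:
  assumes t: "t > 0"
  shows "eta_series (1 / t) = sqrt t * eta_series t"
proof -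
  define g where "g k = exp (- (pi * (of_int k)\<^sup>2 / (12 * t)))" for k :: int
  define d where "d k = cos (pi * of_int k / 6) * (1 - cos (pi * of_int k))" for k :: int
  have sg: "(\<lambda>k::int. g k * cos (2 * pi * real_of_int k * x) / sqrt (12 * t)) summable_on UNIV" for x :: real
  proof -
    have p: "1 / (12 * t) > 0" using t by simp
    have "(\<lambda>k::int. cos (2 * pi * k * x) * exp (- (pi * (1 / (12 * t)) * (0 + k)\<^sup>2))) summable_on UNIV"
      by (rule summable_gaussian[OF p abs_cos_le_one])
    then have "(\<lambda>k::int. 1 / sqrt (12 * t) * (cos (2 * pi * k * x) * exp (- (pi * (1 / (12 * t)) * (0 + k)\<^sup>2)))) summable_on UNIV"
      by (rule summable_on_cmult_right)
    moreover have "1 / sqrt (12 * t) * (cos (2 * pi * k * x) * exp (- (pi * (1 / (12 * t)) * (0 + real_of_int k)\<^sup>2))) = g k * cos (2 * pi * k * x) / sqrt (12 * t)" for k :: int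
      unfolding g_def by simp
    ultimately show ?thesis by (simp only:)
  qed
  have "eta_series t = (\<Sum>\<^sub>\<infinity>k. g k * cos (2 * pi * k * (- 1 / 12)) / sqrt (12 * t)) -
      (\<Sum>\<^sub>\<infinity>k. g k * cos (2 * pi * k * (5 / 12)) / sqrt (12 * t))"
    unfolding eta_series_split[OF t] g_def using t by (subst (1 2) poisson_gaussian) auto
  also have "\<dots> = (\<Sum>\<^sub>\<infinity>k. g k * cos (2 * pi * k * (- 1 / 12)) / sqrt (12 * t) - g k * cos (2 * pi * k * (5 / 12)) / sqrt (12 * t))"
    using infsum_add[OF sg[of "- 1 / 12"] summable_on_uminus[THEN iffD2, OF sg[of "5 / 12"]]]
    by (simp only: infsum_uminus diff_conv_add_uminus)
  also have "\<dots> = (\<Sum>\<^sub>\<infinity>k. g k * d k / sqrt (12 * t))"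
    unfolding d_def cos_twelfth_difference[symmetric] by (simp add: algebra_simps diff_divide_distrib)
  finally have 1: "eta_series t = (\<Sum>\<^sub>\<infinity>k. g k * d k / sqrt (12 * t))" .
  \<comment> \<open>Each of the residue classes -1 and 1 modulo 6 reproduces the series at 1/t,
    because (6 n - 1)^2 / (12 t) = (3/t) (n - 1/6)^2.\<close>
  define A where "A = range (\<lambda>n::int. 6 * n - 1)"
  define B where "B = range (\<lambda>n::int. 1 - 6 * n)"
  define f where "f n = (-1) powi n * exp (- (pi * (3 * (1 / t)) * (- 1 / 6 + of_int n)\<^sup>2))" for n :: int
  have "f summable_on UNIV"
    unfolding f_def using summable_gaussian[of "3 * (1 / t)" "\<lambda>n. (-1) powi n" "- 1 / 6"] t by simp
  then have hf: "(f has_sum eta_series (1 / t)) UNIV"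
    unfolding eta_series_def f_def[symmetric] by (rule has_sum_infsum)
  have gd: "g (6 * n - 1) * d (6 * n - 1) / sqrt (12 * t) = f n * (sqrt 3 / sqrt (12 * t))" for n
    unfolding d_def cos_twelfth_at g_def f_def using t by (simp add: power2_eq_square field_simps)
  have gd': "g (1 - 6 * n) * d (1 - 6 * n) / sqrt (12 * t) = f n * (sqrt 3 / sqrt (12 * t))" for n
  proof -
    have "1 - 6 * n = - (6 * n - 1)" by simp
    moreover have "g (- k) = g k" "d (- k) = d k" for k by (simp_all add: g_def d_def)
    ultimately show ?thesis using gd[of n] by metis
  qed
  have hs: "((\<lambda>n. f n * (sqrt 3 / sqrt (12 * t))) has_sum eta_series (1 / t) * (sqrt 3 / sqrt (12 * t))) UNIV"
    by (rule has_sum_cmult_left[OF hf])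
  have "((\<lambda>k. g k * d k / sqrt (12 * t)) has_sum eta_series (1 / t) * (sqrt 3 / sqrt (12 * t))) A"
    unfolding A_def by (subst has_sum_reindex) (use hs in \<open>auto simp: inj_def o_def gd\<close>)
  moreover have "((\<lambda>k. g k * d k / sqrt (12 * t)) has_sum eta_series (1 / t) * (sqrt 3 / sqrt (12 * t))) B"
    unfolding B_def by (subst has_sum_reindex) (use hs in \<open>auto simp: inj_def o_def gd'\<close>)
  moreover have "A \<inter> B = {}" unfolding A_def B_def by (auto, presburger)
  ultimately have "((\<lambda>k. g k * d k / sqrt (12 * t)) has_sum
      eta_series (1 / t) * (sqrt 3 / sqrt (12 * t)) + eta_series (1 / t) * (sqrt 3 / sqrt (12 * t))) (A \<union> B)"
    by (rule has_sum_Un_disjoint)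
  then have "((\<lambda>k. g k * d k / sqrt (12 * t)) has_sum
      eta_series (1 / t) * (sqrt 3 / sqrt (12 * t)) + eta_series (1 / t) * (sqrt 3 / sqrt (12 * t))) UNIV"
    by (rule has_sum_cong_neutral[THEN iffD1, rotated -1])
       (use cos_twelfth_zero in \<open>auto simp: A_def B_def d_def\<close>)
  then have "eta_series t = eta_series (1 / t) * (sqrt 3 / sqrt (12 * t)) + eta_series (1 / t) * (sqrt 3 / sqrt (12 * t))"
    using 1 by (simp add: infsumI)
  also have "sqrt (12 * t) = 2 * sqrt 3 * sqrt t"
  proof -
    have "sqrt 12 = 2 * sqrt 3" by (rule real_sqrt_unique) auto
    then show ?thesis by (simp add: real_sqrt_mult)
  qed
  finally show ?thesis using t by (simp add: field_simps)
qed

section \<open>The squared eta function on the upper half-plane and its inversion law\<close>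

text \<open>Squaring the eta function gives weight 1, so its transformation law involves no choice
  of a square root.\<close>

definition eta_sq :: "complex \<Rightarrow> complex" where
  "eta_sq \<tau> = exp (2 * pi * \<i> * \<tau> / 12) * f_minus (exp (2 * pi * \<i> * \<tau>)) ^ 2"

lemma norm_nome: "norm (exp (2 * pi * \<i> * \<tau>)) = exp (- (2 * pi * Im \<tau>))"
  by (simp add: norm_exp_eq_Re)

lemma nome_less_1: "Im \<tau> > 0 \<Longrightarrow> norm (exp (2 * pi * \<i> * \<tau>)) < 1"
  by (simp add: norm_nome)

lemma eta_sq_imaginary_axis:
  assumes t: "t > 0"
  shows "eta_sq (\<i> * of_real t) = of_real (eta_series t) ^ 2"
proof -
  define q where "q = exp (- (2 * pi * t))"
  have q: "norm (complex_of_real q) < 1" using t by (simp add: q_def)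
  define e where "e = exp (- (pi * t / 12))"
  have "((\<lambda>n. of_real e * ((-1) powi n * of_real q ^ pent n)) has_sum of_real e * f_minus (of_real q)) UNIV"
    by (intro has_sum_cmult_right has_sum_f_minus(1) q)
  moreover have "of_real e * ((-1) powi n * of_real q ^ pent n)
      = complex_of_real ((-1) powi n * exp (- (pi * (3 * t) * (- 1 / 6 + n)\<^sup>2)))" for n :: int
  proof -
    have "2 * real (pent n) = of_int (n * (3 * n - 1))"
      using arg_cong[OF int_pent[of n], of real_of_int] by simp
    then have *: "real (pent n) = (3 * (real_of_int n)\<^sup>2 - n) / 2" by (simp add: power2_eq_square algebra_simps)
    have "e * q ^ pent n = exp (- (pi * t / 12) + real (pent n) * (- (2 * pi * t)))"
      by (simp only: e_def q_def exp_add exp_of_nat_mult)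
    also have "- (pi * t / 12) + real (pent n) * (- (2 * pi * t)) = - (pi * (3 * t) * (- 1 / 6 + n)\<^sup>2)"
      unfolding * by (simp add: power2_eq_square field_simps)
    finally have "e * q ^ pent n = exp (- (pi * (3 * t) * (- 1 / 6 + n)\<^sup>2))" .
    moreover have "(-1) powi n = complex_of_real ((-1) powi n)"
      by (cases "even n") (auto simp: power_int_minus_left)
    ultimately show ?thesis by (metis of_real_mult of_real_power mult.left_commute)
  qed
  ultimately have "((\<lambda>n::int. complex_of_real ((-1) powi n * exp (- (pi * (3 * t) * (- 1 / 6 + n)\<^sup>2)))) has_sum of_real e * f_minus (of_real q)) UNIV"
    by simp
  moreover have "((\<lambda>n::int. complex_of_real ((-1) powi n * exp (- (pi * (3 * t) * (- 1 / 6 + n)\<^sup>2)))) has_sum of_real (eta_series t)) UNIV"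
    unfolding eta_series_def using t summable_gaussian[of "3 * t" "\<lambda>n. (-1) powi n" "- 1 / 6"]
    by (intro has_sum_of_real has_sum_infsum) simp
  ultimately have 1: "of_real e * f_minus (of_real q) = complex_of_real (eta_series t)"
    by (rule has_sum_unique)
  have "exp (2 * pi * \<i> * (\<i> * of_real t)) = complex_of_real q"
    unfolding q_def exp_of_real[symmetric] by (simp add: algebra_simps)
  moreover have "exp (2 * pi * \<i> * (\<i> * of_real t) / 12) = complex_of_real e ^ 2"
    unfolding e_def exp_of_real[symmetric] exp_double[symmetric] by (simp add: algebra_simps)
  ultimately show ?thesis unfolding eta_sq_def 1[symmetric] by (simp add: power_mult_distrib)
qed

lemma eta_sq_holomorphic: "eta_sq holomorphic_on {\<tau>. Im \<tau> > 0}"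
proof -
  have "(f_minus \<circ> (\<lambda>\<tau>. exp (2 * pi * \<i> * \<tau>))) holomorphic_on {\<tau>. Im \<tau> > 0}"
    by (rule holomorphic_on_compose_gen[OF _ f_minus_holomorphic])
       (auto intro!: holomorphic_intros nome_less_1 simp: dist_norm)
  then show ?thesis unfolding eta_sq_def[abs_def] by (intro holomorphic_intros) (auto simp: o_def)
qed

lemma Im_minus_inverse: "Im (- 1 / \<tau>) = Im \<tau> / (norm \<tau>)\<^sup>2"
  by (simp add: Im_divide cmod_power2)

text \<open>Both sides are holomorphic on the upper half-plane and agree on the imaginary axis by
  \<open>eta_series_inversion\<close>; the identity theorem does the rest.\<close>

lemma eta_sq_inversion:
  assumes "Im \<tau> > 0"
  shows "eta_sq (- 1 / \<tau>) = - \<i> * \<tau> * eta_sq \<tau>"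
proof -
  define H where "H = {\<tau>. Im \<tau> > 0}"
  define F where "F \<tau> = eta_sq (- 1 / \<tau>) + \<i> * \<tau> * eta_sq \<tau>" for \<tau>
  have H0: "\<tau> \<noteq> 0" if "\<tau> \<in> H" for \<tau> using that by (auto simp: H_def)
  have Hi: "Im (- 1 / \<tau>) > 0" if "\<tau> \<in> H" for \<tau>
    unfolding Im_minus_inverse using that H0[OF that] by (simp add: H_def)
  have "(eta_sq \<circ> (\<lambda>\<tau>. - 1 / \<tau>)) holomorphic_on H"
    by (rule holomorphic_on_compose_gen[OF _ eta_sq_holomorphic])
       (use H0 Hi in \<open>auto intro!: holomorphic_intros simp: H_def\<close>)
  then have holF: "F holomorphic_on H"
    unfolding F_def[abs_def] using eta_sq_holomorphic by (intro holomorphic_intros) (auto simp: o_def H_def)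
  have "F \<tau> = 0"
  proof (rule analytic_continuation[OF holF])
    show "open H" unfolding H_def by (rule open_halfspace_Im_gt)
    show "connected H" unfolding H_def by (intro convex_connected convex_halfspace_Im_gt)
    show "(\<lambda>t. \<i> * of_real t) ` {0<..} \<subseteq> H" by (auto simp: H_def)
    show "\<i> \<in> H" by (simp add: H_def)
    show "\<i> islimpt (\<lambda>t. \<i> * of_real t) ` {0<..}"
      unfolding islimpt_approachable
    proof (intro allI impI)
      fix e :: real assume e: "e > 0"
      show "\<exists>x'\<in>(\<lambda>t. \<i> * of_real t) ` {0<..}. x' \<noteq> \<i> \<and> dist x' \<i> < e"
      proof (rule bexI[of _ "\<i> * of_real (1 + e / 2)"])
        have "\<i> * of_real (1 + e / 2) - \<i> = \<i> * of_real (e / 2)" by (simp add: algebra_simps)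
        then have "dist (\<i> * of_real (1 + e / 2)) \<i> = e / 2"
          using e by (simp only: dist_norm norm_mult norm_of_real) simp
        then show "\<i> * of_real (1 + e / 2) \<noteq> \<i> \<and> dist (\<i> * of_real (1 + e / 2)) \<i> < e"
          using e by (metis dist_self half_gt_zero_iff field_sum_of_halves less_add_same_cancel1 less_irrefl)
      qed (use e in \<open>auto intro!: image_eqI[of _ _ "1 + e / 2"]\<close>)
    qed
    show "\<tau> \<in> H" using assms by (simp add: H_def)
    fix z assume "z \<in> (\<lambda>t. \<i> * complex_of_real t) ` {0<..}"
    then obtain t where t: "t > 0" "z = \<i> * of_real t" by auto
    have "- 1 / z = \<i> * of_real (1 / t)" using t by (simp add: field_simps)
    moreover have "complex_of_real (eta_series (1 / t)) ^ 2 = of_real t * of_real (eta_series t) ^ 2"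
      unfolding eta_series_inversion[OF t(1)] using t by (simp add: power_mult_distrib flip: of_real_power)
    ultimately show "F z = 0"
      using t by (simp add: F_def eta_sq_imaginary_axis del: of_real_divide)
  qed
  then show ?thesis by (simp add: F_def add_eq_0_iff)
qed

section \<open>The multiplier system of the squared eta function\<close>

text \<open>Modulo 12 this is the homomorphism from \<open>SL\<^sub>2(\<int>)\<close> onto its abelianization \<open>\<int>/12\<close>.\<close>

definition psi :: "int \<Rightarrow> int \<Rightarrow> int \<Rightarrow> int \<Rightarrow> int" where
  "psi a b c d = (1 - c\<^sup>2) * (b * d + 3 * (c - 1) * d + c + 3) + c * (a + d - 3)"

lemma cong_psi:
  assumes "[a = a'] (mod m)" "[b = b'] (mod m)" "[c = c'] (mod m)" "[d = d'] (mod m)"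
  shows "[psi a b c d = psi a' b' c' d'] (mod m)"
  unfolding psi_def by (intro cong_add cong_diff cong_mult cong_pow cong_refl assms)

text \<open>If X and D respect congruences modulo m, divisibility under the determinant condition is
  a finite check over residues.\<close>

lemma dvd_by_residues:
  fixes m :: int and X D :: "int \<Rightarrow> int \<Rightarrow> int \<Rightarrow> int \<Rightarrow> int"
  assumes X: "\<And>a b c d. [X a b c d = X (a mod m) (b mod m) (c mod m) (d mod m)] (mod m)"
    and D: "\<And>a b c d. [D a b c d = D (a mod m) (b mod m) (c mod m) (d mod m)] (mod m)"
    and m: "m > 1"
    and check: "\<forall>a\<in>set [0..m-1]. \<forall>b\<in>set [0..m-1]. \<forall>c\<in>set [0..m-1]. \<forall>d\<in>set [0..m-1].
       D a b c d mod m = 1 \<longrightarrow> X a b c d mod m = 0"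
    and "D a b c d = 1"
  shows "m dvd X a b c d"
proof -
  have r: "x mod m \<in> set [0..m-1]" for x using m by (simp add: pos_mod_bound)
  have "D (a mod m) (b mod m) (c mod m) (d mod m) mod m = 1"
    using D[of a b c d] assms(5) m by (simp add: cong_def)
  then have "X (a mod m) (b mod m) (c mod m) (d mod m) mod m = 0"
    using check r by blast
  then show ?thesis using X[of a b c d] by (simp add: cong_def dvd_eq_mod_eq_0)
qed

lemma twelve_dvd: "(12::int) dvd x" if "3 dvd x" "4 dvd x"
  using that by presburger

text \<open>Splitting 12 into 3 and 4 leaves 3^4 + 4^4 quadruples to check instead of 12^4.\<close>

lemma twelve_dvd_by_residues:
  fixes X D :: "int \<Rightarrow> int \<Rightarrow> int \<Rightarrow> int \<Rightarrow> int"
  assumes X: "\<And>a b c d m. [X a b c d = X (a mod m) (b mod m) (c mod m) (d mod m)] (mod m)"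
    and D: "\<And>a b c d m. [D a b c d = D (a mod m) (b mod m) (c mod m) (d mod m)] (mod m)"
    and check: "\<forall>m\<in>set [3, 4]. \<forall>a\<in>set [0..m-1]. \<forall>b\<in>set [0..m-1]. \<forall>c\<in>set [0..m-1]. \<forall>d\<in>set [0..m-1].
       D a b c d mod m = 1 \<longrightarrow> X a b c d mod m = 0"
    and det: "D a b c d = 1"
  shows "12 dvd X a b c d"
proof (rule twelve_dvd)
  show "3 dvd X a b c d" by (rule dvd_by_residues[where X = X and D = D and m = 3, OF X D _ _ det]) (use check in simp_all)
  show "4 dvd X a b c d" by (rule dvd_by_residues[where X = X and D = D and m = 4, OF X D _ _ det]) (use check in simp_all)
qed

lemma cong_mod_self: "[a = a mod m] (mod m)" for a m :: int
  by (simp add: cong_def)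

text \<open>The new matrix is the old one multiplied on the left by that of tau -> -1/tau; the 3
  matches \<open>e12 3\<close>, which is the constant i arising from the inversion law.\<close>

lemma psi_inversion:
  assumes "a * d - b * c = 1"
  shows "12 dvd psi (- c) (- d) a b - psi a b c d + 3"
  by (rule twelve_dvd_by_residues[where D = "\<lambda>a b c d. a * d - b * c"
        and X = "\<lambda>a b c d. psi (- c) (- d) a b - psi a b c d + 3", OF _ _ _ assms])
     ((intro cong_add cong_diff cong_mult cong_refl cong_psi cong_minus_minus_iff[THEN iffD2] cong_mod_self)+, code_simp)

text \<open>The expression equals k (1 - c^2) (1 - d^2), and the determinant condition forces 12 to
  divide (1 - c^2) (1 - d^2).\<close>

lemma psi_translation:
  assumes "a * d - b * c = 1"
  shows "12 dvd psi (a - k * c) (b - k * d) c d - psi a b c d + k"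
proof -
  have "12 dvd (1 - c\<^sup>2) * (1 - d\<^sup>2)"
    by (rule twelve_dvd_by_residues[where D = "\<lambda>a b c d. a * d - b * c"
        and X = "\<lambda>a b c d. (1 - c\<^sup>2) * (1 - d\<^sup>2)", OF _ _ _ assms])
     ((intro cong_add cong_diff cong_mult cong_pow cong_refl cong_mod_self)+, code_simp)
  then have "12 dvd k * ((1 - c\<^sup>2) * (1 - d\<^sup>2))" by (rule dvd_mult)
  also have "k * ((1 - c\<^sup>2) * (1 - d\<^sup>2)) = psi (a - k * c) (b - k * d) c d - psi a b c d + k"
    by (simp add: psi_def algebra_simps power2_eq_square)
  finally show ?thesis .
qed

text \<open>An element of Gamma_0(21) acts on tau, 21 tau, 3 tau and 7 tau through these four
  matrices; the multipliers cancel in the quotient \<open>w1_sq\<close>. The next three lemmas do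
  the same for the Atkin--Lehner involutions attached to 3, 7 and 21.\<close>

lemma psi_level_21_1:
  assumes "a * d - 21 * b * c = 1"
  shows "12 dvd psi a b (21 * c) d + psi a (21 * b) c d - psi a (3 * b) (7 * c) d - psi a (7 * b) (3 * c) d"
  by (rule twelve_dvd_by_residues[where D = "\<lambda>a b c d. a * d - 21 * b * c"
        and X = "\<lambda>a b c d. psi a b (21 * c) d + psi a (21 * b) c d - psi a (3 * b) (7 * c) d - psi a (7 * b) (3 * c) d", OF _ _ _ assms])
     ((intro cong_add cong_diff cong_mult cong_refl cong_psi cong_mod_self)+, code_simp)

lemma psi_level_21_3:
  assumes "3 * a * d - 7 * b * c = 1"
  shows "12 dvd psi a b (7 * c) (3 * d) + psi (3 * a) (7 * b) c d - psi (3 * a) b (7 * c) d - psi a (7 * b) c (3 * d)"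
  by (rule twelve_dvd_by_residues[where D = "\<lambda>a b c d. 3 * a * d - 7 * b * c"
        and X = "\<lambda>a b c d. psi a b (7 * c) (3 * d) + psi (3 * a) (7 * b) c d - psi (3 * a) b (7 * c) d - psi a (7 * b) c (3 * d)", OF _ _ _ assms])
     ((intro cong_add cong_diff cong_mult cong_refl cong_psi cong_mod_self)+, code_simp)

lemma psi_level_21_7:
  assumes "7 * a * d - 3 * b * c = 1"
  shows "12 dvd psi a b (3 * c) (7 * d) + psi (7 * a) (3 * b) c d - psi a (3 * b) c (7 * d) - psi (7 * a) b (3 * c) d"
  by (rule twelve_dvd_by_residues[where D = "\<lambda>a b c d. 7 * a * d - 3 * b * c"
        and X = "\<lambda>a b c d. psi a b (3 * c) (7 * d) + psi (7 * a) (3 * b) c d - psi a (3 * b) c (7 * d) - psi (7 * a) b (3 * c) d", OF _ _ _ assms])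
     ((intro cong_add cong_diff cong_mult cong_refl cong_psi cong_mod_self)+, code_simp)

lemma psi_level_21_21:
  assumes "21 * a * d - b * c = 1"
  shows "12 dvd psi a b c (21 * d) + psi (21 * a) b c d - psi (3 * a) b c (7 * d) - psi (7 * a) b c (3 * d)"
  by (rule twelve_dvd_by_residues[where D = "\<lambda>a b c d. 21 * a * d - b * c"
        and X = "\<lambda>a b c d. psi a b c (21 * d) + psi (21 * a) b c d - psi (3 * a) b c (7 * d) - psi (7 * a) b c (3 * d)", OF _ _ _ assms])
     ((intro cong_add cong_diff cong_mult cong_refl cong_psi cong_mod_self)+, code_simp)

section \<open>The transformation law of the squared eta function under SL_2(Z)\<close>

definition e12 :: "int \<Rightarrow> complex" where
  "e12 n = exp (2 * pi * \<i> * of_int n / 12)"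

lemma e12_add: "e12 (m + n) = e12 m * e12 n"
  by (simp add: e12_def exp_add[symmetric] add_divide_distrib ring_distribs)

lemma e12_nonzero [simp]: "e12 n \<noteq> 0"
  by (simp add: e12_def)

lemma exp_2pi_i_int: "exp (2 * of_int k * of_real pi * \<i>) = 1"
  by (auto simp: exp_eq_1 intro!: exI[of _ k])

lemma e12_multiple:
  assumes "12 dvd n"
  shows "e12 n = 1"
proof -
  obtain k where "n = 12 * k" using assms by auto
  then have "2 * pi * \<i> * of_int n / 12 = 2 * of_int k * of_real pi * \<i>" by simp
  then show ?thesis unfolding e12_def by (simp only: exp_2pi_i_int)
qed

lemma e12_3: "e12 3 = \<i>"
proof -
  have "2 * pi * \<i> * of_int 3 / 12 = \<i> * of_real (pi / 2)" by simp
  then show ?thesis unfolding e12_def by (simp only: cis_conv_exp[symmetric] cis_pi_half)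
qed

lemma e12_6: "e12 6 = -1"
  using e12_add[of 3 3] by (simp add: e12_3)

lemma e12_cong: "12 dvd m - n \<Longrightarrow> e12 m = e12 n"
  using e12_add[of "m - n" n] by (simp add: e12_multiple)

lemma eta_sq_plus_int: "eta_sq (\<tau> + of_int b) = e12 b * eta_sq \<tau>"
proof -
  have "exp (2 * pi * \<i> * (\<tau> + of_int b)) = exp (2 * pi * \<i> * \<tau>) * exp (2 * of_int b * of_real pi * \<i>)"
    by (simp add: exp_add[symmetric] algebra_simps)
  also have "\<dots> = exp (2 * pi * \<i> * \<tau>)" by (simp only: exp_2pi_i_int mult_1_right)
  finally have 1: "exp (2 * pi * \<i> * (\<tau> + of_int b)) = exp (2 * pi * \<i> * \<tau>)" .
  have "exp (2 * pi * \<i> * (\<tau> + of_int b) / 12) = e12 b * exp (2 * pi * \<i> * \<tau> / 12)"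
    unfolding e12_def exp_add[symmetric] by (simp add: algebra_simps add_divide_distrib)
  with 1 show ?thesis by (simp add: eta_sq_def)
qed

text \<open>The determinant is kept general, since the Atkin--Lehner matrices have determinants
  other than 1.\<close>

lemma Im_moebius:
  fixes a b c d :: int
  shows "Im ((of_int a * \<tau> + of_int b) / (of_int c * \<tau> + of_int d)) =
    of_int (a * d - b * c) * Im \<tau> / (norm (of_int c * \<tau> + of_int d))\<^sup>2"
  unfolding Im_divide cmod_power2 by (simp add: algebra_simps)

lemma moebius_denominator_nonzero:
  fixes c d :: int
  assumes "Im \<tau> > 0" "c \<noteq> 0 \<or> d \<noteq> 0"
  shows "of_int c * \<tau> + of_int d \<noteq> 0"
proof
  assume 0: "of_int c * \<tau> + of_int d = 0"
  have "of_int c * Im \<tau> = Im (of_int c * \<tau> + of_int d)" by simp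
  also have "\<dots> = 0" unfolding 0 by simp
  finally have "of_int c * Im \<tau> = 0" .
  then have "c = 0" using assms(1) by simp
  with 0 assms(2) show False by simp
qed

text \<open>Euclid's algorithm on the first column: a translation reduces a modulo c, an inversion
  moves the remainder to the lower left corner, and the two congruences for \<open>psi\<close>
  follow the multiplier.\<close>

theorem eta_sq_modular:
  fixes a b c d :: int
  assumes "a * d - b * c = 1" and "Im \<tau> > 0"
  shows "eta_sq ((of_int a * \<tau> + of_int b) / (of_int c * \<tau> + of_int d)) =
    e12 (psi a b c d) * (of_int c * \<tau> + of_int d) * eta_sq \<tau>"
  using assms(1)
proof (induction "nat \<bar>c\<bar>" arbitrary: a b c d rule: less_induct)
  case less
  show ?case
  proof (cases "c = 0")
    case True
    then have "a * d = 1" using less.prems by simp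
    then consider "a = 1" "d = 1" | "a = -1" "d = -1" by (auto simp: zmult_eq_1_iff)
    then show ?thesis
    proof cases
      case 1
      then show ?thesis using True eta_sq_plus_int[of \<tau> b] by (simp add: psi_def)
    next
      case 2
      \<comment> \<open>Here the map is the translation by -b while the factor c tau + d is -1; the
        6 in \<open>psi\<close> = 6 - b compensates this sign.\<close>
      have "e12 (6 - b) = - e12 (- b)" using e12_add[of 6 "- b"] by (simp add: e12_6)
      then show ?thesis using 2 True eta_sq_plus_int[of \<tau> "- b"] by (simp add: psi_def)
    qed
  next
    case False
    define k where "k = a div c"
    define r where "r = a - k * c"
    define s where "s = b - k * d"
    have r: "\<bar>r\<bar> < \<bar>c\<bar>"
      using abs_mod_less[OF False, of a] by (simp add: r_def k_def minus_div_mult_eq_mod)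
    have det: "r * d - s * c = 1" using less.prems by (simp add: r_def s_def algebra_simps)
    have IH: "eta_sq ((of_int (- c) * \<tau> + of_int (- d)) / (of_int r * \<tau> + of_int s)) =
       e12 (psi (- c) (- d) r s) * (of_int r * \<tau> + of_int s) * eta_sq \<tau>"
      by (rule less.hyps) (use r det in \<open>auto simp: algebra_simps\<close>)
    define N where "N = of_int r * \<tau> + of_int s"
    define M where "M = of_int c * \<tau> + of_int d"
    have "r \<noteq> 0 \<or> s \<noteq> 0" "c \<noteq> 0 \<or> d \<noteq> 0" using det by auto
    then have nz: "N \<noteq> 0" "M \<noteq> 0"
      unfolding N_def M_def using moebius_denominator_nonzero[OF assms(2)] by blast+
    define z where "z = - M / N"
    have z: "z = (of_int (- c) * \<tau> + of_int (- d)) / (of_int r * \<tau> + of_int s)"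
      by (simp add: z_def M_def N_def algebra_simps)
    have "Im z > 0" unfolding z Im_moebius using det assms(2) nz by (simp add: N_def algebra_simps)
    have "(of_int a * \<tau> + of_int b) / M = - 1 / z + of_int k"
      using nz by (simp add: z_def field_simps) (simp add: N_def M_def r_def s_def algebra_simps)
    then have "eta_sq ((of_int a * \<tau> + of_int b) / M) = e12 k * (- \<i> * z * eta_sq z)"
      by (simp only: eta_sq_plus_int eta_sq_inversion[OF \<open>Im z > 0\<close>])
    also have "eta_sq z = e12 (psi (- c) (- d) r s) * N * eta_sq \<tau>"
      using IH by (simp add: z N_def)
    also have "e12 k * (- \<i> * z * (e12 (psi (- c) (- d) r s) * N * eta_sq \<tau>)) =
        (e12 k * e12 3 * e12 (psi (- c) (- d) r s)) * M * eta_sq \<tau>"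
      using nz by (simp add: z_def e12_3)
    also have "e12 k * e12 3 * e12 (psi (- c) (- d) r s) = e12 (psi a b c d)"
    proof -
      have "12 dvd (psi (- c) (- d) r s - psi r s c d + 3) + (psi r s c d - psi a b c d + k)"
        using psi_inversion[OF det] psi_translation[OF less.prems, of k]
        unfolding r_def[symmetric] s_def[symmetric] by (rule dvd_add)
      then show ?thesis unfolding e12_add[symmetric] by (intro e12_cong) (simp add: algebra_simps)
    qed
    finally show ?thesis by (simp add: M_def)
  qed
qed

section \<open>Reduction in the upper half-plane and zeros of f(-q)\<close>

text \<open>For y = Im tau < 1, Dirichlet approximation of Re tau with denominators k up to about 1
  / sqrt y gives |k tau - h|^2 <= 4 y + y.\<close>

lemma exists_large_imaginary_part:
  assumes "Im \<tau> > 0"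
  obtains m n :: int where "coprime m n"
    "Im \<tau> / (norm (of_int m * \<tau> + of_int n))\<^sup>2 \<ge> 1 / 5"
proof (cases "Im \<tau> \<ge> 1")
  case True
  then show ?thesis using that[of 0 1] by simp
next
  case False
  define y where "y = Im \<tau>"
  have y: "0 < y" "y < 1" using assms False by (auto simp: y_def)
  define N where "N = nat \<lfloor>1 / sqrt y\<rfloor>"
  have s: "0 < sqrt y" "sqrt y < 1" "sqrt y * sqrt y = y" using y by auto
  have "1 / sqrt y \<ge> 1" using s by simp
  then have N: "N > 0" "real N \<le> 1 / sqrt y" "1 / sqrt y < real N + 1"
    unfolding N_def by linarith+
  obtain h k where hk: "coprime h k" "0 < k" "k \<le> int N" "\<bar>of_int k * Re \<tau> - of_int h\<bar> < 1 / N"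
    using Dirichlet_approx_coprime[OF N(1)] by blast
  have "1 / sqrt y \<le> 2 * real N" using N by linarith
  then have "1 / real N \<le> 2 * sqrt y" using N(1) s(1) by (simp add: field_simps)
  then have "\<bar>of_int k * Re \<tau> - of_int h\<bar> \<le> 2 * sqrt y" using hk(4) by linarith
  then have "\<bar>of_int k * Re \<tau> - of_int h\<bar>\<^sup>2 \<le> (2 * sqrt y)\<^sup>2" by (intro power_mono) auto
  then have 1: "(of_int k * Re \<tau> - of_int h)\<^sup>2 \<le> 4 * y" using y by (simp add: power_mult_distrib)
  have "real_of_int k \<le> 1 / sqrt y" using hk(3) N(2) by linarith
  then have "(real_of_int k)\<^sup>2 \<le> (1 / sqrt y)\<^sup>2" using hk(2) by (intro power_mono) auto
  then have "(real_of_int k)\<^sup>2 * y\<^sup>2 \<le> 1 / y * y\<^sup>2" using y by (intro mult_right_mono) (auto simp: power_divide)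
  then have 2: "(of_int k * y)\<^sup>2 \<le> y" using y by (simp add: power_mult_distrib power2_eq_square)
  have "(norm (of_int k * \<tau> + of_int (- h)))\<^sup>2 = (of_int k * Re \<tau> - of_int h)\<^sup>2 + (of_int k * y)\<^sup>2"
    unfolding cmod_power2 by (simp add: y_def)
  also have "\<dots> \<le> 5 * y" using 1 2 by simp
  finally have le: "(norm (of_int k * \<tau> + of_int (- h)))\<^sup>2 \<le> 5 * y" .
  have "of_int k * \<tau> + of_int (- h) \<noteq> 0" by (rule moebius_denominator_nonzero) (use assms hk in auto)
  then have "0 < (norm (of_int k * \<tau> + of_int (- h)))\<^sup>2" by simp
  then have "1 / 5 \<le> Im \<tau> / (norm (of_int k * \<tau> + of_int (- h)))\<^sup>2"
    using le by (simp add: y_def[symmetric] field_simps)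
  moreover have "coprime k (- h)" using hk(1) by (simp add: coprime_commute)
  ultimately show ?thesis using that by blast
qed

text \<open>Some element of SL_2(Z) moves tau to a point z with Im z >= 1/5. The nome of z has
  modulus below 1/2, where f(-q) has no zero, and the transformation law carries this back to
  tau.\<close>

lemma eta_sq_nonzero:
  assumes "Im \<tau> > 0"
  shows "eta_sq \<tau> \<noteq> 0"
proof -
  obtain m n :: int where mn: "coprime m n"
    "Im \<tau> / (norm (of_int m * \<tau> + of_int n))\<^sup>2 \<ge> 1 / 5"
    using exists_large_imaginary_part[OF assms] by blast
  obtain u v where "u * m + v * n = gcd m n" using bezout_int by blast
  then have det: "v * n - (- u) * m = 1" using mn(1) by (simp add: algebra_simps)
  define z where "z = (of_int v * \<tau> + of_int (- u)) / (of_int m * \<tau> + of_int n)"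
  have "Im z \<ge> 1 / 5" unfolding z_def Im_moebius det using mn(2) by simp
  then have "- (2 * pi * Im z) \<le> - (6 / 5)" using pi_gt3 mult_mono[of 3 pi "1/5" "Im z"] by simp
  then have "norm (exp (2 * pi * \<i> * z)) \<le> exp (- (6 / 5))" unfolding norm_nome by simp
  also have "exp (- (6 / 5)) < (1 / 2 :: real)"
    using exp_ge_add_one_self[of "6/5"] by (simp add: exp_minus field_simps)
  finally have "f_minus (exp (2 * pi * \<i> * z)) \<noteq> 0" by (rule f_minus_nonzero_small)
  then have "eta_sq z \<noteq> 0" by (simp add: eta_sq_def)
  then show ?thesis unfolding z_def eta_sq_modular[OF det assms] by simp
qed

lemma nome_surj:
  assumes "q \<noteq> 0" "norm q < 1"
  obtains \<tau> where "Im \<tau> > 0" "q = exp (2 * pi * \<i> * \<tau>)"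
proof
  show "q = exp (2 * pi * \<i> * (Ln q / (2 * pi * \<i>)))" using assms by simp
  have "Ln q / (2 * pi * \<i>) = - \<i> * Ln q / of_real (2 * pi)" by (simp add: field_simps)
  then have "Im (Ln q / (2 * pi * \<i>)) = - ln (norm q) / (2 * pi)"
    using assms by (simp only: Im_divide_of_real) simp
  then show "Im (Ln q / (2 * pi * \<i>)) > 0" using assms by (simp add: divide_neg_pos)
qed

lemma f_minus_nonzero:
  assumes "norm q < 1"
  shows "f_minus q \<noteq> 0"
proof (cases "q = 0")
  case False
  then obtain \<tau> where "Im \<tau> > 0" "q = exp (2 * pi * \<i> * \<tau>)" using nome_surj assms by blast
  then show ?thesis using eta_sq_nonzero[of \<tau>] by (auto simp: eta_sq_def)
qed simp

section \<open>Atkin--Lehner involutions of level 105\<close>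

text \<open>\<open>w\<^sub>1\<^sup>2\<close> as a function of \<open>\<tau>\<close>; the square of \<open>w\<^sub>5\<close> is its value at \<open>5\<tau>\<close>.\<close>

definition w1_sq :: "complex \<Rightarrow> complex" where
  "w1_sq \<tau> = eta_sq \<tau> * eta_sq (21 * \<tau>) / (eta_sq (3 * \<tau>) * eta_sq (7 * \<tau>))"

text \<open>With denominators cleared, the law for a multiple of z follows by scaling the equation
  that defines z.\<close>

lemma eta_sq_moebius:
  fixes a b c d :: int
  assumes "a * d - b * c = 1" "Im \<tau> > 0"
    and "z * (of_int c * \<tau> + of_int d) = of_int a * \<tau> + of_int b"
  shows "eta_sq z = e12 (psi a b c d) * (of_int c * \<tau> + of_int d) * eta_sq \<tau>"
proof -
  have "c \<noteq> 0 \<or> d \<noteq> 0" using assms(1) by auto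
  then have "of_int c * \<tau> + of_int d \<noteq> 0" by (rule moebius_denominator_nonzero[OF assms(2)])
  then have "z = (of_int a * \<tau> + of_int b) / (of_int c * \<tau> + of_int d)"
    using assms(3) by (simp add: field_simps)
  then show ?thesis using eta_sq_modular[OF assms(1,2)] by simp
qed

text \<open>The common automorphy factor G cancels between numerator and denominator, as do the
  roots of unity and the scalar factors.\<close>

lemma eta_quotient_combine:
  fixes G :: complex
  assumes "E1 = e12 p1 * (k1 * G) * A1" "E2 = e12 p2 * (k2 * G) * A2"
    and "E3 = e12 p3 * (k3 * G) * A3" "E4 = e12 p4 * (k4 * G) * A4"
    and "12 dvd p1 + p2 - p3 - p4" and "k1 * k2 = k3 * k4" and "G \<noteq> 0" "k3 \<noteq> 0" "k4 \<noteq> 0"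
  shows "E1 * E2 / (E3 * E4) = A1 * A2 / (A3 * A4)"
proof -
  have "e12 (p1 + p2) = e12 (p3 + p4)" by (rule e12_cong) (use assms(5) in \<open>simp add: algebra_simps\<close>)
  then have "E1 * E2 = (e12 (p3 + p4) * (k3 * k4) * G\<^sup>2) * (A1 * A2)"
    unfolding assms(1,2) assms(6)[symmetric] by (simp add: e12_add power2_eq_square mult_ac)
  moreover have "E3 * E4 = (e12 (p3 + p4) * (k3 * k4) * G\<^sup>2) * (A3 * A4)"
    unfolding assms(3,4) by (simp add: e12_add power2_eq_square mult_ac)
  moreover have "e12 (p3 + p4) * (k3 * k4) * G\<^sup>2 \<noteq> 0" using assms by simp
  ultimately show ?thesis by simp
qed

lemma w1_sq_level_1:
  fixes a b c d :: int
  assumes det: "a * d - 21 * b * c = 1" and \<tau>: "Im \<tau> > 0"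
    and z: "z * (of_int (21 * c) * \<tau> + of_int d) = of_int a * \<tau> + of_int b"
  shows "w1_sq z = w1_sq \<tau>"
proof -
  define G where "G = of_int (21 * c) * \<tau> + of_int d"
  have "21 * c \<noteq> 0 \<or> d \<noteq> 0" using det by auto
  then have G: "G \<noteq> 0" unfolding G_def by (rule moebius_denominator_nonzero[OF \<tau>])
  have 1: "eta_sq z = e12 (psi a b (21 * c) d) * (1 * G) * eta_sq \<tau>"
    by (subst eta_sq_moebius[of a d b "21 * c" \<tau>]) (use det \<tau> z in \<open>auto simp: G_def algebra_simps\<close>)
  have 2: "eta_sq (21 * z) = e12 (psi a (21 * b) c d) * (1 * G) * eta_sq (21 * \<tau>)"
    by (subst eta_sq_moebius[of a d "21 * b" c "21 * \<tau>"]) (use det \<tau> arg_cong[OF z, of "\<lambda>x. 21 * x"] in \<open>auto simp: G_def algebra_simps\<close>)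
  have 3: "eta_sq (3 * z) = e12 (psi a (3 * b) (7 * c) d) * (1 * G) * eta_sq (3 * \<tau>)"
    by (subst eta_sq_moebius[of a d "3 * b" "7 * c" "3 * \<tau>"]) (use det \<tau> arg_cong[OF z, of "\<lambda>x. 3 * x"] in \<open>auto simp: G_def algebra_simps\<close>)
  have 4: "eta_sq (7 * z) = e12 (psi a (7 * b) (3 * c) d) * (1 * G) * eta_sq (7 * \<tau>)"
    by (subst eta_sq_moebius[of a d "7 * b" "3 * c" "7 * \<tau>"]) (use det \<tau> arg_cong[OF z, of "\<lambda>x. 7 * x"] in \<open>auto simp: G_def algebra_simps\<close>)
  show ?thesis unfolding w1_sq_def
    by (rule eta_quotient_combine[OF 1 2 3 4 psi_level_21_1[OF det] _ G]) auto
qed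

text \<open>Up to SL_2(Z), the points z, 21 z, 3 z, 7 z are 3 tau, 7 tau, tau, 21 tau, so numerator
  and denominator trade places.\<close>

lemma w1_sq_level_3:
  fixes a b c d :: int
  assumes det: "3 * a * d - 7 * b * c = 1" and \<tau>: "Im \<tau> > 0"
    and z: "z * (3 * (of_int (7 * c) * \<tau> + of_int d)) = of_int (3 * a) * \<tau> + of_int b"
  shows "w1_sq z = 1 / w1_sq \<tau>"
proof -
  define G where "G = of_int (7 * c) * \<tau> + of_int d"
  have "7 * c \<noteq> 0 \<or> d \<noteq> 0" using det by auto
  then have G: "G \<noteq> 0" unfolding G_def by (rule moebius_denominator_nonzero[OF \<tau>])
  have 1: "eta_sq z = e12 (psi a b (7 * c) (3 * d)) * (3 * G) * eta_sq (3 * \<tau>)"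
    by (subst eta_sq_moebius[of a "3 * d" b "7 * c" "3 * \<tau>"]) (use det \<tau> z in \<open>auto simp: G_def algebra_simps\<close>)
  have 2: "eta_sq (21 * z) = e12 (psi (3 * a) (7 * b) c d) * (1 * G) * eta_sq (7 * \<tau>)"
    by (subst eta_sq_moebius[of "3 * a" d "7 * b" c "7 * \<tau>"]) (use det \<tau> arg_cong[OF z, of "\<lambda>x. 7 * x"] in \<open>auto simp: G_def algebra_simps\<close>)
  have 3: "eta_sq (3 * z) = e12 (psi (3 * a) b (7 * c) d) * (1 * G) * eta_sq \<tau>"
    by (subst eta_sq_moebius[of "3 * a" d b "7 * c" \<tau>]) (use det \<tau> z in \<open>auto simp: G_def algebra_simps\<close>)
  have 4: "eta_sq (7 * z) = e12 (psi a (7 * b) c (3 * d)) * (3 * G) * eta_sq (21 * \<tau>)"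
    by (subst eta_sq_moebius[of a "3 * d" "7 * b" c "21 * \<tau>"]) (use det \<tau> arg_cong[OF z, of "\<lambda>x. 7 * x"] in \<open>auto simp: G_def algebra_simps\<close>)
  have "w1_sq z = eta_sq (3 * \<tau>) * eta_sq (7 * \<tau>) / (eta_sq \<tau> * eta_sq (21 * \<tau>))"
    unfolding w1_sq_def by (rule eta_quotient_combine[OF 1 2 3 4 psi_level_21_3[OF det] _ G]) auto
  then show ?thesis by (simp add: w1_sq_def)
qed

text \<open>Up to SL_2(Z), the points z, 21 z, 3 z, 7 z are 7 tau, 3 tau, 21 tau, tau; again
  numerator and denominator trade places.\<close>

lemma w1_sq_level_7:
  fixes a b c d :: int
  assumes det: "7 * a * d - 3 * b * c = 1" and \<tau>: "Im \<tau> > 0"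
    and z: "z * (7 * (of_int (3 * c) * \<tau> + of_int d)) = of_int (7 * a) * \<tau> + of_int b"
  shows "w1_sq z = 1 / w1_sq \<tau>"
proof -
  define G where "G = of_int (3 * c) * \<tau> + of_int d"
  have "3 * c \<noteq> 0 \<or> d \<noteq> 0" using det by auto
  then have G: "G \<noteq> 0" unfolding G_def by (rule moebius_denominator_nonzero[OF \<tau>])
  have 1: "eta_sq z = e12 (psi a b (3 * c) (7 * d)) * (7 * G) * eta_sq (7 * \<tau>)"
    by (subst eta_sq_moebius[of a "7 * d" b "3 * c" "7 * \<tau>"]) (use det \<tau> z in \<open>auto simp: G_def algebra_simps\<close>)
  have 2: "eta_sq (21 * z) = e12 (psi (7 * a) (3 * b) c d) * (1 * G) * eta_sq (3 * \<tau>)"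
    by (subst eta_sq_moebius[of "7 * a" d "3 * b" c "3 * \<tau>"]) (use det \<tau> arg_cong[OF z, of "\<lambda>x. 3 * x"] in \<open>auto simp: G_def algebra_simps\<close>)
  have 3: "eta_sq (3 * z) = e12 (psi a (3 * b) c (7 * d)) * (7 * G) * eta_sq (21 * \<tau>)"
    by (subst eta_sq_moebius[of a "7 * d" "3 * b" c "21 * \<tau>"]) (use det \<tau> arg_cong[OF z, of "\<lambda>x. 3 * x"] in \<open>auto simp: G_def algebra_simps\<close>)
  have 4: "eta_sq (7 * z) = e12 (psi (7 * a) b (3 * c) d) * (1 * G) * eta_sq \<tau>"
    by (subst eta_sq_moebius[of "7 * a" d b "3 * c" \<tau>]) (use det \<tau> z in \<open>auto simp: G_def algebra_simps\<close>)
  have "w1_sq z = eta_sq (7 * \<tau>) * eta_sq (3 * \<tau>) / (eta_sq (21 * \<tau>) * eta_sq \<tau>)"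
    unfolding w1_sq_def by (rule eta_quotient_combine[OF 1 2 3 4 psi_level_21_7[OF det] _ G]) auto
  then show ?thesis by (simp add: w1_sq_def mult.commute)
qed

text \<open>Now tau is paired with 21 tau and 3 tau with 7 tau, so numerator and denominator are
  each preserved.\<close>

lemma w1_sq_level_21:
  fixes a b c d :: int
  assumes det: "21 * a * d - b * c = 1" and \<tau>: "Im \<tau> > 0"
    and z: "z * (21 * (of_int c * \<tau> + of_int d)) = of_int (21 * a) * \<tau> + of_int b"
  shows "w1_sq z = w1_sq \<tau>"
proof -
  define G where "G = of_int c * \<tau> + of_int d"
  have "c \<noteq> 0 \<or> d \<noteq> 0" using det by auto
  then have G: "G \<noteq> 0" unfolding G_def by (rule moebius_denominator_nonzero[OF \<tau>])
  have 1: "eta_sq z = e12 (psi a b c (21 * d)) * (21 * G) * eta_sq (21 * \<tau>)"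
    by (subst eta_sq_moebius[of a "21 * d" b c "21 * \<tau>"]) (use det \<tau> z in \<open>auto simp: G_def algebra_simps\<close>)
  have 2: "eta_sq (21 * z) = e12 (psi (21 * a) b c d) * (1 * G) * eta_sq \<tau>"
    by (subst eta_sq_moebius[of "21 * a" d b c \<tau>]) (use det \<tau> z in \<open>auto simp: G_def algebra_simps\<close>)
  have 3: "eta_sq (3 * z) = e12 (psi (3 * a) b c (7 * d)) * (7 * G) * eta_sq (7 * \<tau>)"
    by (subst eta_sq_moebius[of "3 * a" "7 * d" b c "7 * \<tau>"]) (use det \<tau> z in \<open>auto simp: G_def algebra_simps\<close>)
  have 4: "eta_sq (7 * z) = e12 (psi (7 * a) b c (3 * d)) * (3 * G) * eta_sq (3 * \<tau>)"
    by (subst eta_sq_moebius[of "7 * a" "3 * d" b c "3 * \<tau>"]) (use det \<tau> z in \<open>auto simp: G_def algebra_simps\<close>)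
  have "w1_sq z = eta_sq (21 * \<tau>) * eta_sq \<tau> / (eta_sq (7 * \<tau>) * eta_sq (3 * \<tau>))"
    unfolding w1_sq_def by (rule eta_quotient_combine[OF 1 2 3 4 psi_level_21_21[OF det] _ G]) auto
  then show ?thesis by (simp add: w1_sq_def mult.commute)
qed

lemma w1_sq_atkin_lehner:
  fixes a b c d e f :: int
  assumes "e \<in> {1, 3, 7, 21}" "e * f = 21"
    and "e * a * d - f * b * c = 1" and "Im \<tau> > 0"
    and "z * (of_int e * (of_int (f * c) * \<tau> + of_int d)) = of_int (e * a) * \<tau> + of_int b"
  shows "w1_sq z = (if e \<in> {1, 21} then w1_sq \<tau> else 1 / w1_sq \<tau>)"
proof -
  consider "e = 1" "f = 21" | "e = 3" "f = 7" | "e = 7" "f = 3" | "e = 21" "f = 1"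
    using assms(1,2) by auto
  then show ?thesis
  proof cases
    case 1 then show ?thesis using w1_sq_level_1[of a d b c \<tau> z] assms by simp
  next
    case 2 then show ?thesis using w1_sq_level_3[of a d b c \<tau> z] assms by simp
  next
    case 3 then show ?thesis using w1_sq_level_7[of a d b c \<tau> z] assms by simp
  next
    case 4 then show ?thesis using w1_sq_level_21[of a d b c \<tau> z] assms by simp
  qed
qed

section \<open>Moving a point up by an Atkin--Lehner involution of level 105\<close>

lemma divisors_105:
  fixes g :: int
  assumes "g dvd 105" "g > 0"
  shows "g \<in> {1, 3, 5, 7, 15, 21, 35, 105}"
proof -
  have "g \<le> 105" using assms by (intro zdvd_imp_le) auto
  then have "g \<in> {1..105}" using assms by simp
  also have "{1..105::int} = set [1..105]" by simp
  finally have "g \<in> set [1..105]" .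
  moreover have "\<forall>g\<in>set [1..105]. (105::int) mod g = 0 \<longrightarrow> g \<in> set [1, 3, 5, 7, 15, 21, 35, 105]"
    by code_simp
  ultimately show ?thesis using assms(1) by (auto simp: dvd_eq_mod_eq_0)
qed

text \<open>Given coprime \<open>m\<close> and \<open>n\<close>, the involution attached to \<open>e = 105 / gcd(m, 105)\<close> can be chosen with a bottom row
  proportional to \<open>(m, n)\<close>, because 105 is squarefree; this costs at most a factor 105 in the imaginary part.\<close>

lemma atkin_lehner_reduction:
  assumes \<tau>: "Im \<tau> > 0"
  obtains z where "Im z \<ge> 1 / 525"
    "(w1_sq z, w1_sq (5 * z)) \<in> {(w1_sq \<tau>, w1_sq (5 * \<tau>)), (1 / w1_sq \<tau>, 1 / w1_sq (5 * \<tau>)),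
       (w1_sq (5 * \<tau>), w1_sq \<tau>), (1 / w1_sq (5 * \<tau>), 1 / w1_sq \<tau>)}"
proof -
  obtain m n :: int where mn: "coprime m n"
    "Im \<tau> / (norm (of_int m * \<tau> + of_int n))\<^sup>2 \<ge> 1 / 5"
    using exists_large_imaginary_part[OF \<tau>] by blast
  define g where "g = gcd m 105"
  have g: "g dvd 105" "g > 0" "g dvd m" by (auto simp: g_def)
  define e where "e = 105 div g"
  have eg: "e * g = 105" using g by (simp add: e_def)
  have e0: "e > 0" using eg g(2) by (metis zero_less_mult_pos2 zero_less_numeral)
  have e: "e dvd 105" using eg by (metis dvd_triv_left)
  \<comment> \<open>A common divisor p of m and e also divides g, so p^2 divides e g = 105, which is
    squarefree.\<close>
  have "coprime m e"
  proof -
    define p where "p = gcd m e"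
    have "p dvd g" unfolding g_def p_def using e by (metis dvd_trans gcd_dvd1 gcd_dvd2 gcd_greatest)
    moreover have "p dvd e" by (simp add: p_def)
    ultimately have "p * p dvd 105" using eg by (metis mult_dvd_mono)
    moreover have "p \<in> {1, 3, 5, 7, 15, 21, 35, 105}"
      using e e0 unfolding p_def by (intro divisors_105) (auto intro: dvd_trans[OF gcd_dvd2])
    ultimately have "p = 1" by auto
    then show ?thesis by (simp add: p_def coprime_iff_gcd_eq_1)
  qed
  then have "coprime (e * n) m" using mn(1) by (simp add: coprime_commute)
  moreover obtain u v where "u * (e * n) + v * m = gcd (e * n) m" using bezout_int by blast
  ultimately have det: "e * u * n - (- v) * m = 1" by (simp add: algebra_simps)
  define a where "a = u"
  define b where "b = - v"
  note det = det[folded a_def b_def]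
  define D where "D = of_int m * \<tau> + of_int n"
  have "m \<noteq> 0 \<or> n \<noteq> 0" using det by auto
  then have D: "D \<noteq> 0" unfolding D_def by (rule moebius_denominator_nonzero[OF \<tau>])
  \<comment> \<open>The matrix has bottom row e (m, n) and determinant e, so Im z is 1/e times Im
    tau / |m tau + n|^2, and e <= 105.\<close>
  define z where "z = (of_int (e * a) * \<tau> + of_int b) / (of_int (e * m) * \<tau> + of_int (e * n))"
  have zD: "z * (of_int e * D) = of_int (e * a) * \<tau> + of_int b"
  proof -
    have "of_int (e * m) * \<tau> + of_int (e * n) = of_int e * D" by (simp add: D_def algebra_simps)
    then show ?thesis using D e0 by (simp add: z_def)
  qed
  have "Im z = of_int e * Im \<tau> / (norm (of_int e * D))\<^sup>2"
    unfolding z_def Im_moebius using arg_cong[OF det, of "\<lambda>x. of_int (e * x) :: real"]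
    by (simp add: D_def algebra_simps)
  also have "\<dots> = (1 / of_int e) * (Im \<tau> / (norm D)\<^sup>2)"
    using e0 by (simp add: norm_mult power_mult_distrib power2_eq_square)
  also have "\<dots> \<ge> (1 / 105) * (1 / 5)"
    using mn(2) e0 zdvd_imp_le[OF e] \<tau> unfolding D_def by (intro mult_mono) (auto simp: field_simps)
  finally have Im: "Im z \<ge> 1 / 525" by simp
  have \<tau>5: "Im (5 * \<tau>) > 0" using \<tau> by simp
  \<comment> \<open>\<open>e1\<close> is the part of e prime to 5 and \<open>f\<close> the
    complementary divisor of 21: they describe the action on the level-21 function
    \<open>w1_sq\<close>.\<close>
  define f where "f = (if 5 dvd m then g div 5 else g)"
  define e1 where "e1 = (if 5 dvd m then e else e div 5)"
  have gcases: "g \<in> {1, 3, 5, 7, 15, 21, 35, 105}" by (rule divisors_105) (use g in auto)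
  have d5: "5 dvd m \<longleftrightarrow> 5 dvd g" by (simp add: g_def)
  have e1: "e1 \<in> {1, 3, 7, 21}" "e1 * f = 21"
    using gcases d5 by (auto simp: e1_def f_def e_def)
  obtain k where k: "m = g * k" using g(3) by auto
  \<comment> \<open>If 5 divides m, then e is prime to 5 and the involution treats tau and 5 tau
    separately; otherwise 5 divides e and they are exchanged.\<close>
  show ?thesis
  proof (cases "5 dvd m")
    case True
    then have ge: "g = 5 * f" "e1 = e" using d5 by (auto simp: f_def e1_def)
    have "w1_sq z = (if e1 \<in> {1, 21} then w1_sq \<tau> else 1 / w1_sq \<tau>)"
      by (rule w1_sq_atkin_lehner[of _ f a n b "5 * k"]) (use e1 \<tau> det zD in \<open>auto simp: k ge D_def algebra_simps\<close>)
    moreover have "w1_sq (5 * z) = (if e1 \<in> {1, 21} then w1_sq (5 * \<tau>) else 1 / w1_sq (5 * \<tau>))"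
      by (rule w1_sq_atkin_lehner[of _ f a n "5 * b" k]) (use e1 \<tau> det arg_cong[OF zD, of "\<lambda>x. 5 * x"] in \<open>auto simp: k ge D_def algebra_simps\<close>)
    ultimately show ?thesis using Im that by (cases "e1 \<in> {1, 21}") auto
  next
    case False
    then have ge: "g = f" by (auto simp: f_def)
    have e5: "e = 5 * e1" using False gcases d5 by (auto simp: e1_def e_def)
    have "w1_sq z = (if e1 \<in> {1, 21} then w1_sq (5 * \<tau>) else 1 / w1_sq (5 * \<tau>))"
      by (rule w1_sq_atkin_lehner[of _ f a "5 * n" b k]) (use e1 \<tau> det zD in \<open>auto simp: k ge e5 D_def algebra_simps\<close>)
    moreover have "w1_sq (5 * z) = (if e1 \<in> {1, 21} then w1_sq \<tau> else 1 / w1_sq \<tau>)"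
      by (rule w1_sq_atkin_lehner[of _ f "5 * a" n b k]) (use e1 \<tau> det zD in \<open>auto simp: k ge e5 D_def algebra_simps\<close>)
    ultimately show ?thesis using Im that by (cases "e1 \<in> {1, 21}") auto
  qed
qed

section \<open>Taylor coefficients\<close>

fun leval :: "int list \<Rightarrow> complex \<Rightarrow> complex" where
  "leval [] q = 0"
| "leval (x # xs) q = of_int x + q * leval xs q"

fun ladd :: "int list \<Rightarrow> int list \<Rightarrow> int list" where
  "ladd [] ys = ys"
| "ladd xs [] = xs"
| "ladd (x # xs) (y # ys) = (x + y) # ladd xs ys"

text \<open>The first argument is the number of coefficients kept, so this is the product modulo
  q^n.\<close>

fun lmult :: "nat \<Rightarrow> int list \<Rightarrow> int list \<Rightarrow> int list" where
  "lmult 0 xs ys = []"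
| "lmult (Suc n) [] ys = []"
| "lmult (Suc n) (x # xs) ys = ladd (map ((*) x) (take (Suc n) ys)) (0 # lmult n xs ys)"

lemma leval_ladd: "leval (ladd xs ys) q = leval xs q + leval ys q"
  by (induction xs ys rule: ladd.induct) (auto simp: algebra_simps)

lemma leval_map: "leval (map ((*) c) xs) q = of_int c * leval xs q"
  by (induction xs) (auto simp: algebra_simps)

lemma leval_holomorphic: "leval xs holomorphic_on S"
proof (induction xs)
  case (Cons x xs)
  then show ?case by (auto simp: fun_eq_iff intro!: holomorphic_intros cong: holomorphic_cong)
qed (simp add: holomorphic_on_const[of 0, unfolded] fun_eq_iff)

lemma leval_take: "leval ys q = leval (take n ys) q + q ^ n * leval (drop n ys) q"
proof (induction ys arbitrary: n)
  case (Cons y ys)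
  show ?case
  proof (cases n)
    case (Suc k)
    then show ?thesis using Cons[of k] by (simp add: algebra_simps)
  qed simp
qed simp

text \<open>The discarded terms again form a coefficient list, so the truncation error is q^n times
  a polynomial.\<close>

lemma leval_lmult: "\<exists>zs. \<forall>q. leval xs q * leval ys q = leval (lmult n xs ys) q + q ^ n * leval zs q"
proof (induction n xs ys rule: lmult.induct)
  case (1 xs ys)
  have "\<exists>zs. \<forall>q. leval zs q = leval xs q * leval ys q"
  proof (induction xs)
    case Nil
    then show ?case by (intro exI[of _ "[]"]) simp
  next
    case (Cons x xs)
    then obtain zs where "\<forall>q. leval zs q = leval xs q * leval ys q" by blast
    then show ?case
      by (intro exI[of _ "ladd (map ((*) x) ys) (0 # zs)"]) (auto simp: leval_ladd leval_map algebra_simps)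
  qed
  then show ?case by simp metis
next
  case (2 n ys)
  then show ?case by (intro exI[of _ "[]"]) simp
next
  case (3 n x xs ys)
  then obtain zs where zs: "\<forall>q. leval xs q * leval ys q = leval (lmult n xs ys) q + q ^ n * leval zs q" by blast
  show ?case
  proof (intro exI[of _ "ladd (map ((*) x) (drop (Suc n) ys)) zs"] allI)
    fix q
    have "leval (x # xs) q * leval ys q = of_int x * leval ys q + q * (leval xs q * leval ys q)"
      by (simp add: algebra_simps)
    also have "\<dots> = of_int x * (leval (take (Suc n) ys) q + q ^ Suc n * leval (drop (Suc n) ys) q)
        + q * (leval (lmult n xs ys) q + q ^ n * leval zs q)"
      by (simp only: zs[rule_format, symmetric] leval_take[of ys q "Suc n", symmetric])
    finally show "leval (x # xs) q * leval ys q = leval (lmult (Suc n) (x # xs) ys) q +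
        q ^ Suc n * leval (ladd (map ((*) x) (drop (Suc n) ys)) zs) q"
      by (simp add: leval_ladd leval_map algebra_simps)
  qed
qed

text \<open>\<open>expands f xs\<close>: \<open>f\<close> is holomorphic on the unit disc and its Taylor coefficients at 0 below degree 13
  are those of \<open>xs\<close>.\<close>

definition expands :: "(complex \<Rightarrow> complex) \<Rightarrow> int list \<Rightarrow> bool" where
  "expands f xs \<longleftrightarrow> (\<exists>h. h holomorphic_on ball 0 1 \<and> (\<forall>q\<in>ball 0 1. f q = leval xs q + q ^ 13 * h q))"

lemma expandsI:
  assumes "h holomorphic_on ball 0 1" "\<And>q. norm q < 1 \<Longrightarrow> f q = leval xs q + q ^ 13 * h q"
  shows "expands f xs"
  unfolding expands_def using assms by (intro exI[of _ h]) auto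

lemma expandsE:
  assumes "expands f xs"
  obtains h where "h holomorphic_on ball 0 1" "\<And>q. norm q < 1 \<Longrightarrow> f q = leval xs q + q ^ 13 * h q"
  using assms unfolding expands_def by auto

lemma expands_holomorphic:
  assumes "expands f xs"
  shows "f holomorphic_on ball 0 1"
proof -
  obtain h where h: "h holomorphic_on ball 0 1" "\<And>q. norm q < 1 \<Longrightarrow> f q = leval xs q + q ^ 13 * h q"
    by (rule expandsE[OF assms]) blast
  have "(\<lambda>q. leval xs q + q ^ 13 * h q) holomorphic_on ball 0 1"
    by (intro holomorphic_intros h leval_holomorphic)
  then show ?thesis by (rule holomorphic_transform) (use h in auto)
qed

lemma expands_leval: "expands (leval xs) xs"
  by (rule expandsI[where h = "\<lambda>_. 0"]) auto

lemma expands_add: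
  assumes "expands f xs" "expands g ys" "ladd xs ys = zs"
  shows "expands (\<lambda>q. f q + g q) zs"
proof -
  obtain h where h: "h holomorphic_on ball 0 1" "\<And>q. norm q < 1 \<Longrightarrow> f q = leval xs q + q ^ 13 * h q"
    by (rule expandsE[OF assms(1)]) blast
  obtain k where k: "k holomorphic_on ball 0 1" "\<And>q. norm q < 1 \<Longrightarrow> g q = leval ys q + q ^ 13 * k q"
    by (rule expandsE[OF assms(2)]) blast
  show ?thesis
    by (rule expandsI[where h = "\<lambda>q. h q + k q"])
       (use h k in \<open>auto intro!: holomorphic_intros simp: leval_ladd algebra_simps simp flip: assms(3)\<close>)
qed

lemma expands_mult:
  assumes "expands f xs" "expands g ys" "lmult 13 xs ys = zs"
  shows "expands (\<lambda>q. f q * g q) zs"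
proof -
  obtain h where h: "h holomorphic_on ball 0 1" "\<And>q. norm q < 1 \<Longrightarrow> f q = leval xs q + q ^ 13 * h q"
    by (rule expandsE[OF assms(1)]) blast
  obtain k where k: "k holomorphic_on ball 0 1" "\<And>q. norm q < 1 \<Longrightarrow> g q = leval ys q + q ^ 13 * k q"
    by (rule expandsE[OF assms(2)]) blast
  obtain us where us: "\<And>q. leval xs q * leval ys q = leval zs q + q ^ 13 * leval us q"
    using leval_lmult[of xs ys 13] assms(3) by auto
  show ?thesis
  proof (rule expandsI)
    show "(\<lambda>q. leval us q + leval xs q * k q + h q * leval ys q + q ^ 13 * (h q * k q)) holomorphic_on ball 0 1"
      by (intro holomorphic_intros h k leval_holomorphic)
    fix q :: complex assume "norm q < 1"
    then have "f q * g q = leval xs q * leval ys q +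
        q ^ 13 * (leval xs q * k q + h q * leval ys q + q ^ 13 * (h q * k q))"
      by (simp only: h(2) k(2)) (simp add: ring_distribs mult_ac)
    then show "f q * g q = leval zs q + q ^ 13 * (leval us q + leval xs q * k q + h q * leval ys q + q ^ 13 * (h q * k q))"
      unfolding us by (simp only: distrib_left add.assoc)
  qed
qed

text \<open>The coefficients of the quotient are supplied and verified by multiplying back; the
  absence of zeros of g keeps the remainder holomorphic.\<close>

lemma expands_divide:
  assumes "expands f xs" "expands g ys" "\<And>q. norm q < 1 \<Longrightarrow> g q \<noteq> 0" "lmult 13 zs ys = xs"
  shows "expands (\<lambda>q. f q / g q) zs"
proof -
  obtain h where h: "h holomorphic_on ball 0 1" "\<And>q. norm q < 1 \<Longrightarrow> f q = leval xs q + q ^ 13 * h q"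
    by (rule expandsE[OF assms(1)]) blast
  obtain k where k: "k holomorphic_on ball 0 1" "\<And>q. norm q < 1 \<Longrightarrow> leval zs q * g q = leval xs q + q ^ 13 * k q"
    by (rule expandsE[OF expands_mult[OF expands_leval assms(2,4)]]) blast
  show ?thesis
  proof (rule expandsI)
    show "(\<lambda>q. (h q - k q) / g q) holomorphic_on ball 0 1"
      using assms(3) by (intro holomorphic_intros h k expands_holomorphic[OF assms(2)]) auto
    fix q :: complex assume q: "norm q < 1"
    have "f q = leval zs q * g q + q ^ 13 * (h q - k q)"
      using h(2)[OF q] k(2)[OF q] by (simp add: algebra_simps)
    then show "f q / g q = leval zs q + q ^ 13 * ((h q - k q) / g q)"
      using assms(3)[OF q] by (simp add: field_simps)
  qed
qed

section \<open>Expansions of f_n, of P and Q, and of the modular relation\<close>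

lemma f_sub_expansion:
  assumes "n > 0"
  obtains h where "h holomorphic_on ball 0 1"
    "\<And>q. norm q < 1 \<Longrightarrow> f_sub q n = 1 - q ^ n - q ^ (2 * n) + q ^ (5 * n) + q ^ (7 * n) - q ^ (12 * n) + q ^ (13 * n) * h q"
proof -
  obtain h where h: "h holomorphic_on ball 0 1"
    "\<forall>q\<in>ball 0 1. f_minus q = 1 - q - q^2 + q^5 + q^7 - q^12 + q ^ 13 * h q"
    using f_minus_expansion by blast
  have pow: "norm (q ^ n) < 1" if "norm q < 1" for q :: complex
    using that assms by (simp add: norm_power power_less_one_iff)
  have "(h \<circ> (\<lambda>q. q ^ n)) holomorphic_on ball 0 1"
    by (rule holomorphic_on_compose_gen[OF _ h(1)]) (auto intro!: holomorphic_intros simp: pow)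
  moreover have "f_sub q n = 1 - q ^ n - q ^ (2 * n) + q ^ (5 * n) + q ^ (7 * n) - q ^ (12 * n) + q ^ (13 * n) * (h \<circ> (\<lambda>q. q ^ n)) q"
    if "norm q < 1" for q
    using h(2) pow[OF that] by (simp add: f_sub_def power_mult[symmetric] mult.commute)
  ultimately show ?thesis by (rule that)
qed

lemma f_sub_nonzero:
  assumes "norm q < 1" "n > 0"
  shows "f_sub q n \<noteq> 0"
  unfolding f_sub_def by (rule f_minus_nonzero) (use assms in \<open>simp add: norm_power power_less_one_iff\<close>)

lemma expands_f_sub_1: "expands (\<lambda>q. f_sub q 1) [1, -1, -1, 0, 0, 1, 0, 1, 0, 0, 0, 0, -1]"
proof -
  obtain h where h: "h holomorphic_on ball 0 1"
    "\<forall>q\<in>ball 0 1. f_minus q = 1 - q - q^2 + q^5 + q^7 - q^12 + q ^ 13 * h q"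
    using f_minus_expansion by blast
  show ?thesis by (rule expandsI[OF h(1)]) (simp add: f_sub_def h(2), algebra)
qed

text \<open>From n = 3 on, the terms starting with q^(5 n) have degree at least 15 and go into the
  remainder.\<close>

lemma f_sub_expansion_ge_3:
  assumes "n \<ge> 3"
  obtains h where "h holomorphic_on ball 0 1" "\<And>q. norm q < 1 \<Longrightarrow> f_sub q n = 1 - q ^ n - q ^ (2 * n) + q ^ 13 * h q"
proof -
  obtain h where h: "h holomorphic_on ball 0 1"
    "\<And>q. norm q < 1 \<Longrightarrow> f_sub q n = 1 - q ^ n - q ^ (2 * n) + q ^ (5 * n) + q ^ (7 * n) - q ^ (12 * n) + q ^ (13 * n) * h q"
    using f_sub_expansion[of n] assms by auto
  have split: "q ^ (j * n) = q ^ 13 * q ^ (j * n - 13)" if "j \<ge> 5" for q :: complex and j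
  proof -
    have "5 * 3 \<le> j * n" using that assms by (intro mult_mono) auto
    then show ?thesis by (simp flip: power_add)
  qed
  show ?thesis
  proof (rule that)
    show "(\<lambda>q. q ^ (5 * n - 13) + q ^ (7 * n - 13) - q ^ (12 * n - 13) + q ^ (13 * n - 13) * h q) holomorphic_on ball 0 1"
      by (intro holomorphic_intros h)
    fix q :: complex assume "norm q < 1"
    then show "f_sub q n = 1 - q ^ n - q ^ (2 * n) + q ^ 13 * (q ^ (5 * n - 13) + q ^ (7 * n - 13) - q ^ (12 * n - 13) + q ^ (13 * n - 13) * h q)"
      using h(2)[of q] split[of 5 q] split[of 7 q] split[of 12 q] split[of 13 q] by (simp add: ring_distribs mult.assoc)
  qed
qed

lemma expands_f_sub_3: "expands (\<lambda>q. f_sub q 3) [1, 0, 0, -1, 0, 0, -1]"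
proof -
  obtain h where h: "h holomorphic_on ball 0 1" "\<And>q. norm q < 1 \<Longrightarrow> f_sub q 3 = 1 - q ^ 3 - q ^ (2 * 3) + q ^ 13 * h q"
    using f_sub_expansion_ge_3[of 3] by auto
  show ?thesis by (rule expandsI[OF h(1)]) (simp add: h(2), algebra)
qed

lemma expands_f_sub_5: "expands (\<lambda>q. f_sub q 5) [1, 0, 0, 0, 0, -1, 0, 0, 0, 0, -1]"
proof -
  obtain h where h: "h holomorphic_on ball 0 1" "\<And>q. norm q < 1 \<Longrightarrow> f_sub q 5 = 1 - q ^ 5 - q ^ (2 * 5) + q ^ 13 * h q"
    using f_sub_expansion_ge_3[of 5] by auto
  show ?thesis by (rule expandsI[OF h(1)]) (simp add: h(2), algebra)
qed

lemma expands_f_sub_7: "expands (\<lambda>q. f_sub q 7) [1, 0, 0, 0, 0, 0, 0, -1]"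
proof -
  obtain h where h: "h holomorphic_on ball 0 1" "\<And>q. norm q < 1 \<Longrightarrow> f_sub q 7 = 1 - q ^ 7 - q ^ (2 * 7) + q ^ 13 * h q"
    using f_sub_expansion_ge_3[of 7] by auto
  \<comment> \<open>The term -q^14 is beyond the cut and enters the remainder as q^13 (-q).\<close>
  have "(\<lambda>q. h q - q) holomorphic_on ball 0 1" by (intro holomorphic_intros h)
  then show ?thesis by (rule expandsI) (simp add: h(2), algebra)
qed

lemma expands_f_sub_ge_13:
  assumes "n \<ge> 13"
  shows "expands (\<lambda>q. f_sub q n) [1]"
proof -
  obtain h where h: "h holomorphic_on ball 0 1" "\<And>q. norm q < 1 \<Longrightarrow> f_sub q n = 1 - q ^ n - q ^ (2 * n) + q ^ 13 * h q"
    using f_sub_expansion_ge_3[of n] assms by auto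
  have "q ^ j = q ^ 13 * q ^ (j - 13)" if "j \<ge> 13" for q :: complex and j
    using that by (simp flip: power_add)
  note split = this[of n] this[of "2 * n"]
  show ?thesis
  proof (rule expandsI)
    show "(\<lambda>q. h q - q ^ (n - 13) - q ^ (2 * n - 13)) holomorphic_on ball 0 1" by (intro holomorphic_intros h)
    fix q :: complex assume "norm q < 1"
    then show "f_sub q n = leval [1] q + q ^ 13 * (h q - q ^ (n - 13) - q ^ (2 * n - 13))"
      using h(2)[of q] split[of q] assms by (simp add: right_diff_distrib)
  qed
qed

text \<open>With these, \<open>P = q\<^sup>3 P_unit q\<close> and \<open>Q = Q_unit q / q\<^sup>2\<close>.\<close>

definition P_unit :: "complex \<Rightarrow> complex" where
  "P_unit q = f_sub q 1 * f_sub q 5 * f_sub q 21 * f_sub q 105 / (f_sub q 3 * f_sub q 7 * f_sub q 15 * f_sub q 35)"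

definition Q_unit :: "complex \<Rightarrow> complex" where
  "Q_unit q = f_sub q 1 * f_sub q 15 * f_sub q 21 * f_sub q 35 / (f_sub q 3 * f_sub q 5 * f_sub q 7 * f_sub q 105)"

lemma expands_units:
  shows "expands P_unit [1, -1, -1, 1, -1, -1, 3, 1, -3, 3, -2, -3, 5]"
    and "expands (\<lambda>q. 1 / P_unit q) [1, 1, 2, 2, 4, 6, 8, 10, 14, 18, 27, 32, 43]"
    and "expands Q_unit [1, -1, -1, 1, -1, 1, 1, -1, -1, 1, 1, -2, 2]"
    and "expands (\<lambda>q. 1 / Q_unit q) [1, 1, 2, 2, 4, 4, 6, 6, 10, 10, 14, 15, 21]"
proof -
  note e = expands_f_sub_1 expands_f_sub_3 expands_f_sub_5 expands_f_sub_7
    expands_f_sub_ge_13[of 15, simplified] expands_f_sub_ge_13[of 21, simplified]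
    expands_f_sub_ge_13[of 35, simplified] expands_f_sub_ge_13[of 105, simplified]
  \<comment> \<open>\<open>NA\<close> and \<open>DA\<close> are numerator and denominator of
    \<open>P_unit\<close>, \<open>NB\<close> and \<open>DB\<close> those of \<open>Q_unit\<close>.
    Trailing zeros are kept because the lists are compared literally.\<close>
  have NA: "expands (\<lambda>q. f_sub q 1 * f_sub q 5 * f_sub q 21 * f_sub q 105) [1, -1, -1, 0, 0, 0, 1, 2, 0, 0, -2, 1, -1]"
    by (rule expands_mult[OF expands_mult[OF expands_mult[OF e(1) e(3) refl] e(6) refl] e(8)]) code_simp
  have DA: "expands (\<lambda>q. f_sub q 3 * f_sub q 7 * f_sub q 15 * f_sub q 35) [1, 0, 0, -1, 0, 0, -1, -1, 0, 0, 1, 0, 0]"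
    by (rule expands_mult[OF expands_mult[OF expands_mult[OF e(2) e(4) refl] e(5) refl] e(7)]) code_simp
  have NB: "expands (\<lambda>q. f_sub q 1 * f_sub q 15 * f_sub q 21 * f_sub q 35) [1, -1, -1, 0, 0, 1, 0, 1, 0, 0, 0, 0, -1]"
    by (rule expands_mult[OF expands_mult[OF expands_mult[OF e(1) e(5) refl] e(6) refl] e(7)]) code_simp
  have DB: "expands (\<lambda>q. f_sub q 3 * f_sub q 5 * f_sub q 7 * f_sub q 105) [1, 0, 0, -1, 0, -1, -1, -1, 1, 0, 0, 1, 1]"
    by (rule expands_mult[OF expands_mult[OF expands_mult[OF e(2) e(3) refl] e(4) refl] e(8)]) code_simp
  note nz = f_sub_nonzero
  show "expands P_unit [1, -1, -1, 1, -1, -1, 3, 1, -3, 3, -2, -3, 5]"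
    unfolding P_unit_def[abs_def] by (rule expands_divide[OF NA DA]) (simp add: nz, code_simp)
  show "expands (\<lambda>q. 1 / P_unit q) [1, 1, 2, 2, 4, 6, 8, 10, 14, 18, 27, 32, 43]"
    unfolding P_unit_def divide_divide_eq_right mult_1 by (rule expands_divide[OF DA NA]) (simp add: nz, code_simp)
  show "expands Q_unit [1, -1, -1, 1, -1, 1, 1, -1, -1, 1, 1, -2, 2]"
    unfolding Q_unit_def[abs_def] by (rule expands_divide[OF NB DB]) (simp add: nz, code_simp)
  show "expands (\<lambda>q. 1 / Q_unit q) [1, 1, 2, 2, 4, 4, 6, 6, 10, 10, 14, 15, 21]"
    unfolding Q_unit_def divide_divide_eq_right mult_1 by (rule expands_divide[OF DB NB]) (simp add: nz, code_simp)
qed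

lemma units_nonzero:
  assumes "norm q < 1"
  shows "P_unit q \<noteq> 0" "Q_unit q \<noteq> 0"
  using assms by (auto simp: P_unit_def Q_unit_def f_sub_nonzero)

text \<open>The numerators in \<open>P + 1/P = x_num q / q\<^sup>3\<close> and \<open>Q + 1/Q = y_num q / q\<^sup>2\<close>.\<close>

definition x_num where "x_num q = q ^ 6 * P_unit q + 1 / P_unit q"
definition y_num where "y_num q = Q_unit q + q ^ 4 * (1 / Q_unit q)"

lemma expands_power: "expands (\<lambda>q. q ^ n) (replicate n 0 @ [1])"
proof -
  have "leval (replicate n 0 @ [1]) q = q ^ n" for q by (induction n) auto
  then show ?thesis using expands_leval[of "replicate n 0 @ [1]"] by (simp add: expands_def)
qed

lemma expands_x_num: "expands x_num [1, 1, 2, 2, 4, 6, 9, 9, 13, 19, 26, 31, 46]"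
  unfolding x_num_def[abs_def]
  by (rule expands_add[OF expands_mult[OF expands_power expands_units(1) refl] expands_units(2)]) code_simp

lemma expands_y_num: "expands y_num [1, -1, -1, 1, 0, 2, 3, 1, 3, 5, 7, 4, 12]"
  unfolding y_num_def[abs_def]
  by (rule expands_add[OF expands_units(3) expands_mult[OF expands_power expands_units(4) refl]]) code_simp

text \<open>\<open>q\<^sup>6 F(x, y)\<close>, written so that its Taylor coefficients can be computed term by term.\<close>

definition F_pos where
  "F_pos q = x_num q * x_num q + leval [0, -5] q * (x_num q * y_num q) + leval [0, 0, 0, -10] q * x_num q + leval [-1] q * (y_num q * (y_num q * y_num q))
     + leval [0, 0, -5] q * (y_num q * y_num q) + leval [0, 0, 0, 0, -17] q * y_num q + leval [0, 0, 0, 0, 0, 0, -27] q"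

text \<open>The coefficient comparison behind the modular equation: all terms of q^6 F(x, y) below
  degree 13 cancel.\<close>

lemma expands_F_pos: "expands F_pos (replicate 13 0)"
  unfolding F_pos_def[abs_def]
  by (rule expands_add[OF expands_add[OF expands_add[OF expands_add[OF expands_add[OF expands_add[OF
      expands_mult[OF expands_x_num expands_x_num refl]
      expands_mult[OF expands_leval expands_mult[OF expands_x_num expands_y_num refl] refl] refl]
      expands_mult[OF expands_leval expands_x_num refl] refl]
      expands_mult[OF expands_leval expands_mult[OF expands_y_num expands_mult[OF expands_y_num expands_y_num refl] refl] refl] refl]
      expands_mult[OF expands_leval expands_mult[OF expands_y_num expands_y_num refl] refl] refl]
      expands_mult[OF expands_leval expands_y_num refl] refl]
      expands_leval]) code_simp

section \<open>The modular equation\<close>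

text \<open>\<open>q\<^sup>6 F(-x, -y)\<close>\<close>

definition F_neg where
  "F_neg q = x_num q ^ 2 - 5 * q * x_num q * y_num q + 10 * q ^ 3 * x_num q + y_num q ^ 3 - 5 * q\<^sup>2 * y_num q ^ 2 + 17 * q ^ 4 * y_num q - 27 * q ^ 6"

lemma F_pos_eq: "F_pos q = x_num q ^ 2 - 5 * q * x_num q * y_num q - 10 * q ^ 3 * x_num q - y_num q ^ 3 - 5 * q\<^sup>2 * y_num q ^ 2 - 17 * q ^ 4 * y_num q - 27 * q ^ 6"
  by (simp add: F_pos_def power2_eq_square power3_eq_cube eval_nat_numeral algebra_simps)

text \<open>\<open>F(x, y) F(-x, -y)\<close> in terms of \<open>U = w\<^sub>1\<^sup>2\<close> and \<open>V = w\<^sub>5\<^sup>2\<close>, which determine \<open>x\<^sup>2\<close>, \<open>xy\<close> and \<open>y\<^sup>2\<close>.\<close>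

definition F_product :: "complex \<Rightarrow> complex \<Rightarrow> complex" where
  "F_product U V = (let A = U * V + 1 / (U * V) + 2; B = U / V + V / U + 2; S = U + 1 / U + V + 1 / V in
     (A - 5 * S - 5 * B - 27) ^ 2 - (100 * A + 20 * S * B + 340 * S + B ^ 3 + 34 * B ^ 2 + 289 * B))"

text \<open>With the next lemma this covers all four alternatives in
  \<open>atkin_lehner_reduction\<close>.\<close>

lemma F_product_symmetric: "F_product V U = F_product U V"
  by (simp add: F_product_def Let_def mult.commute add.commute add.left_commute)

lemma F_product_inverse: "F_product (1 / U) (1 / V) = F_product U V"
  by (simp add: F_product_def Let_def add.commute add.left_commute)

text \<open>Here A = x^2, B = y^2 and S = x y. With E = x^2 - 5 x y - 5 y^2 - 27 and O = 10 x + y^3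
  + 17 y, the factors are E - O and E + O, and E^2 - O^2 involves only A, B and S.\<close>

lemma F_product_factorization:
  assumes "P \<noteq> 0" "Q \<noteq> 0"
  shows "F_product (P * Q) (P / Q) =
    ((P + 1/P) ^ 2 - 5 * (P + 1/P) * (Q + 1/Q) - 10 * (P + 1/P) - (Q + 1/Q) ^ 3 - 5 * (Q + 1/Q) ^ 2 - 17 * (Q + 1/Q) - 27) *
    ((P + 1/P) ^ 2 - 5 * (P + 1/P) * (Q + 1/Q) + 10 * (P + 1/P) + (Q + 1/Q) ^ 3 - 5 * (Q + 1/Q) ^ 2 + 17 * (Q + 1/Q) - 27)"
proof -
  define x where "x = P + 1/P"
  define y where "y = Q + 1/Q"
  have 1: "P * Q * (P / Q) + 1 / (P * Q * (P / Q)) + 2 = x * x"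
    using assms by (simp add: x_def field_simps)
  have 2: "P * Q / (P / Q) + P / Q / (P * Q) + 2 = y * y"
    using assms by (simp add: y_def field_simps)
  have 3: "P * Q + 1 / (P * Q) + P / Q + 1 / (P / Q) = x * y"
    using assms by (simp add: x_def y_def field_simps)
  show ?thesis
    unfolding F_product_def Let_def 1 2 3 x_def[symmetric] y_def[symmetric]
    by (simp add: power2_eq_square power3_eq_cube algebra_simps)
qed

lemma exp_nome_power: "exp (2 * pi * \<i> * (of_nat n * \<tau>)) = exp (2 * pi * \<i> * \<tau>) ^ n"
  by (simp add: exp_of_nat_mult[symmetric] algebra_simps)

lemma eta_sq_multiple:
  "eta_sq (of_nat n * \<tau>) = exp (2 * pi * \<i> * \<tau> / 12) ^ n * f_sub (exp (2 * pi * \<i> * \<tau>)) n ^ 2"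
proof -
  have "exp (2 * pi * \<i> * (of_nat n * \<tau>) / 12) = exp (2 * pi * \<i> * \<tau> / 12) ^ n"
  proof -
    have "2 * pi * \<i> * (of_nat n * \<tau>) / 12 = of_nat n * (2 * pi * \<i> * \<tau> / 12)" by simp
    then show ?thesis by (simp only: exp_of_nat_mult)
  qed
  then show ?thesis by (simp only: eta_sq_def exp_nome_power f_sub_def)
qed

text \<open>The powers of exp (2 pi i tau / 12) add up to 1 + 21 - 3 - 7 = 12 and 5 + 105 - 15 - 35
  = 60, which gives q and q^5.\<close>

lemma w1_sq_nome:
  assumes "Im \<tau> > 0" and q: "q = exp (2 * pi * \<i> * \<tau>)"
  shows "w1_sq \<tau> = q * P_unit q * Q_unit q" "w1_sq (5 * \<tau>) = q ^ 5 * P_unit q / Q_unit q"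
proof -
  have q1: "norm q < 1" using assms nome_less_1 by simp
  define e where "e = exp (2 * pi * \<i> * \<tau> / 12)"
  have "e ^ 12 = exp (of_nat 12 * (2 * pi * \<i> * \<tau> / 12))" unfolding exp_of_nat_mult e_def ..
  also have "of_nat 12 * (2 * pi * \<i> * \<tau> / 12) = 2 * pi * \<i> * \<tau>" by simp
  finally have e: "e \<noteq> 0" "e ^ 12 = q" unfolding q by (simp_all add: e_def)
  have E: "eta_sq (of_nat n * \<tau>) = e ^ n * f_sub q n ^ 2" for n
    by (simp add: eta_sq_multiple e_def q)
  note nz = f_sub_nonzero[OF q1]
  have quot: "(a * F1) * (b * F2) / ((c * F3) * (d * F4)) = g * ((F1 * F2) / (F3 * F4))"
    if "a * b = g * (c * d)" "c \<noteq> 0" "d \<noteq> 0" for a b c d g F1 F2 F3 F4 :: complex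
  proof -
    have "(a * F1) * (b * F2) / ((c * F3) * (d * F4)) = (a * b) * (F1 * F2) / ((c * d) * (F3 * F4))"
      by (simp add: mult_ac)
    then show ?thesis unfolding that(1) using that(2,3) by simp
  qed
  have "w1_sq \<tau> = (e ^ 1 * f_sub q 1 ^ 2) * (e ^ 21 * f_sub q 21 ^ 2) / ((e ^ 3 * f_sub q 3 ^ 2) * (e ^ 7 * f_sub q 7 ^ 2))"
    unfolding w1_sq_def E[symmetric] by simp
  also have "\<dots> = e ^ 12 * ((f_sub q 1 ^ 2 * f_sub q 21 ^ 2) / (f_sub q 3 ^ 2 * f_sub q 7 ^ 2))"
    by (rule quot) (use e(1) in \<open>simp_all flip: power_add power_Suc\<close>)
  finally show "w1_sq \<tau> = q * P_unit q * Q_unit q"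
    unfolding e(2) using nz by (simp add: P_unit_def Q_unit_def field_simps power2_eq_square)
  have "w1_sq (5 * \<tau>) = (e ^ 5 * f_sub q 5 ^ 2) * (e ^ 105 * f_sub q 105 ^ 2) / ((e ^ 15 * f_sub q 15 ^ 2) * (e ^ 35 * f_sub q 35 ^ 2))"
    unfolding w1_sq_def E[symmetric] by simp
  also have "\<dots> = (e ^ 12) ^ 5 * ((f_sub q 5 ^ 2 * f_sub q 105 ^ 2) / (f_sub q 15 ^ 2 * f_sub q 35 ^ 2))"
    by (rule quot) (use e(1) in \<open>simp_all flip: power_add power_mult\<close>)
  finally show "w1_sq (5 * \<tau>) = q ^ 5 * P_unit q / Q_unit q"
    unfolding e(2) using nz by (simp add: P_unit_def Q_unit_def field_simps power2_eq_square)
qed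

lemma F_pos_F_neg:
  assumes q: "q \<noteq> 0" "norm q < 1"
  shows "F_pos q * F_neg q = q ^ 12 * F_product (q * P_unit q * Q_unit q) (q ^ 5 * P_unit q / Q_unit q)"
proof -
  note nz = units_nonzero[OF q(2)]
  define P where "P = q ^ 3 * P_unit q"
  define Q where "Q = Q_unit q / q\<^sup>2"
  have PQ: "P \<noteq> 0" "Q \<noteq> 0" using nz q by (auto simp: P_def Q_def)
  have 1: "q * P_unit q * Q_unit q = P * Q" "q ^ 5 * P_unit q / Q_unit q = P / Q"
    using nz q by (auto simp: P_def Q_def field_simps eval_nat_numeral)
  define x where "x = P + 1/P"
  define y where "y = Q + 1/Q"
  have x_num: "x_num q = q ^ 3 * x" and y_num: "y_num q = q ^ 2 * y"
    using nz q by (auto simp: x_num_def y_num_def x_def y_def P_def Q_def field_simps eval_nat_numeral)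
  show ?thesis
    unfolding 1 F_product_factorization[OF PQ] F_pos_eq F_neg_def x_num y_num x_def[symmetric] y_def[symmetric] by algebra
qed

lemma F_neg_holomorphic: "F_neg holomorphic_on ball 0 1"
  unfolding F_neg_def[abs_def]
  by (intro holomorphic_intros expands_holomorphic[OF expands_x_num] expands_holomorphic[OF expands_y_num])

text \<open>The leading terms of x^2 and y^3 at q = 0 are both q^(-6); they add up here and cancel
  in \<open>F_pos\<close>.\<close>

lemma F_neg_0: "F_neg 0 = 2"
  by (simp add: F_neg_def x_num_def y_num_def P_unit_def Q_unit_def f_sub_def)

section \<open>Maximum modulus and the vanishing of F\<close>

text \<open>All values are already taken on a compact subdisc, so the modulus has an interior
  maximum.\<close>

lemma holomorphic_constant_if_attained_on_cball:
  fixes g :: "complex \<Rightarrow> complex"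
  assumes g: "g holomorphic_on ball 0 1" and \<rho>: "0 \<le> \<rho>" "\<rho> < 1"
    and att: "\<And>q. norm q < 1 \<Longrightarrow> \<exists>q'. norm q' \<le> \<rho> \<and> g q = g q'"
    and q: "norm q < 1"
  shows "g q = g 0"
proof -
  have sub: "cball 0 \<rho> \<subseteq> ball (0::complex) 1" using \<rho> by auto
  have "continuous_on (cball 0 \<rho>) (\<lambda>z. norm (g z))"
    using holomorphic_on_imp_continuous_on[OF g] sub by (intro continuous_on_norm) (rule continuous_on_subset)
  then obtain \<xi> where \<xi>: "\<xi> \<in> cball 0 \<rho>" "\<And>z. z \<in> cball 0 \<rho> \<Longrightarrow> norm (g z) \<le> norm (g \<xi>)"
    using continuous_attains_sup[OF compact_cball, of 0 \<rho> "\<lambda>z. norm (g z)"] \<rho> by auto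
  have "g constant_on ball 0 1"
  proof (rule maximum_modulus_principle[OF g])
    show "\<xi> \<in> ball 0 1" using \<xi>(1) sub by blast
    fix z :: complex assume "z \<in> ball 0 1"
    then obtain z' where "norm z' \<le> \<rho>" "g z = g z'" using att[of z] by auto
    then show "norm (g z) \<le> norm (g \<xi>)" using \<xi>(2)[of z'] by simp
  qed auto
  then show ?thesis using q unfolding constant_on_def by (metis mem_ball_0 norm_zero zero_less_one)
qed

lemma F_pos_eq_0:
  assumes "norm q < 1"
  shows "F_pos q = 0"
proof -
  obtain h where h: "h holomorphic_on ball 0 1" "\<And>q. norm q < 1 \<Longrightarrow> F_pos q = leval (replicate 13 0) q + q ^ 13 * h q"
    by (rule expandsE[OF expands_F_pos]) blast
  have "leval (replicate n 0) q = 0" for n q by (induction n) auto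
  then have Kh: "F_pos q = q ^ 13 * h q" if "norm q < 1" for q using h(2)[OF that] by simp
  \<comment> \<open>This extends F(x, y) F(-x, -y) across q = 0; the spare factor q, from 13 = 12 +
    1, makes the extension vanish there.\<close>
  define g where "g q = q * h q * F_neg q" for q
  have g_eq: "g (exp (2 * pi * \<i> * \<tau>)) = F_product (w1_sq \<tau>) (w1_sq (5 * \<tau>))" if \<tau>: "Im \<tau> > 0" for \<tau>
  proof -
    define q where "q = exp (2 * pi * \<i> * \<tau>)"
    have q: "q \<noteq> 0" "norm q < 1" using \<tau> nome_less_1 by (auto simp: q_def)
    have "q ^ 12 * g q = F_pos q * F_neg q" by (simp add: g_def Kh[OF q(2)] eval_nat_numeral)
    also have "\<dots> = q ^ 12 * F_product (w1_sq \<tau>) (w1_sq (5 * \<tau>))"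
      unfolding w1_sq_nome[OF \<tau> q_def] by (rule F_pos_F_neg[OF q])
    finally have "g q = F_product (w1_sq \<tau>) (w1_sq (5 * \<tau>))" using q(1) by simp
    then show ?thesis by (simp only: q_def)
  qed
  \<comment> \<open>The radius of the disc of nomes that corresponds to Im z >= 1/525.\<close>
  define \<rho> where "\<rho> = exp (- (2 * pi / 525))"
  have g0: "g q = g 0" if "norm q < 1" for q
  proof (rule holomorphic_constant_if_attained_on_cball[OF _ _ _ _ that])
    show "g holomorphic_on ball 0 1"
      unfolding g_def[abs_def] by (intro holomorphic_intros h F_neg_holomorphic)
    show "0 \<le> \<rho>" "\<rho> < 1" by (auto simp: \<rho>_def)
    fix q :: complex assume q: "norm q < 1"
    show "\<exists>q'. norm q' \<le> \<rho> \<and> g q = g q'"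
    proof (cases "q = 0")
      case True
      then show ?thesis by (intro exI[of _ 0]) (simp add: \<rho>_def)
    next
      case False
      then obtain \<tau> where \<tau>: "Im \<tau> > 0" "q = exp (2 * pi * \<i> * \<tau>)" using nome_surj q by blast
      obtain z where z: "Im z \<ge> 1 / 525"
        "(w1_sq z, w1_sq (5 * z)) \<in> {(w1_sq \<tau>, w1_sq (5 * \<tau>)), (1 / w1_sq \<tau>, 1 / w1_sq (5 * \<tau>)),
          (w1_sq (5 * \<tau>), w1_sq \<tau>), (1 / w1_sq (5 * \<tau>), 1 / w1_sq \<tau>)}"
        by (rule atkin_lehner_reduction[OF \<tau>(1)])
      have "F_product (w1_sq z) (w1_sq (5 * z)) = F_product (w1_sq \<tau>) (w1_sq (5 * \<tau>))"
        using z(2) F_product_inverse F_product_symmetric by auto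
      then have "g q = g (exp (2 * pi * \<i> * z))"
        using g_eq[of z] g_eq[OF \<tau>(1)] z(1) \<tau>(2) by simp
      moreover have "norm (exp (2 * pi * \<i> * z)) \<le> \<rho>"
        unfolding norm_nome \<rho>_def using mult_left_mono[OF z(1), of "2 * pi"] by simp
      ultimately show ?thesis by blast
    qed
  qed
  have KL: "F_pos q * F_neg q = 0" if "norm q < 1" for q
    using g0[OF that] Kh[OF that] by (auto simp: g_def)
  \<comment> \<open>Since \<open>F_neg\<close> is nonzero near 0, the vanishing product gives
    \<open>F_pos\<close> = 0 near 0, and analytic continuation extends this to the disc.\<close>
  have "isCont F_neg 0"
    using holomorphic_on_imp_continuous_on[OF F_neg_holomorphic] by (simp add: continuous_on_eq_continuous_at)
  then obtain d where d: "d > 0" "\<And>z. dist 0 z < d \<Longrightarrow> F_neg z \<noteq> 0"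
    using continuous_at_avoid[of 0 F_neg 0] F_neg_0 by auto
  show ?thesis
  proof (rule analytic_continuation_open[where f = F_pos and z = q and g = "\<lambda>_. 0" and s = "ball 0 (min d 1)" and s' = "ball 0 1"])
    show "F_pos holomorphic_on ball 0 1" by (rule expands_holomorphic[OF expands_F_pos])
    show "F_pos z = 0" if "z \<in> ball 0 (min d 1)" for z
      using that d(2)[of z] KL[of z] by auto
  qed (use assms d(1) in auto)
qed

theorem theorem3p7:
  fixes q s P Q :: complex
  assumes "0 < norm q" and "norm q < 1"
    and "s ^ 2 = q"
    and "\<And>t :: real. 0 < t \<Longrightarrow> t < 1 \<Longrightarrow> q = of_real t \<Longrightarrow> s = of_real (sqrt t)"
    and "P = w q s 1 * w q s 5"
    and "Q = w q s 1 / w q s 5"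
  shows "P ^ 2 + 1 / P ^ 2 =
    Q ^ 3 + 1 / Q ^ 3 + 5 * (Q ^ 2 + 1 / Q ^ 2) + 20 * (Q + 1 / Q)
    + 5 * (P + 1 / P) * ((Q + 1 / Q) + 2) + 35"
proof -
  have q: "q \<noteq> 0" "norm q < 1" using assms(1,2) by auto
  have s: "s \<noteq> 0" using q(1) assms(3) by auto
  note nz = f_sub_nonzero[OF q(2)]
  \<comment> \<open>The powers of s combine to 1 + 5 = 6 in P and 1 - 5 = -4 in Q; both are even,
    hence powers of q.\<close>
  have "P = s ^ 6 * P_unit q"
    using nz s by (simp add: assms(5) w_def P_unit_def field_simps eval_nat_numeral)
  also have "s ^ 6 = q ^ 3" unfolding assms(3)[symmetric] by (simp flip: power_mult)
  finally have P: "P = q ^ 3 * P_unit q" .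
  have "Q = Q_unit q / s ^ 4"
    using nz s by (simp add: assms(6) w_def Q_unit_def field_simps eval_nat_numeral)
  also have "s ^ 4 = q\<^sup>2" unfolding assms(3)[symmetric] by (simp flip: power_mult)
  finally have Q: "Q = Q_unit q / q\<^sup>2" .
  have PQ: "P \<noteq> 0" "Q \<noteq> 0" using units_nonzero[OF q(2)] q by (auto simp: P Q)
  define x where "x = P + 1/P"
  define y where "y = Q + 1/Q"
  have x_num: "x_num q = q ^ 3 * x" and y_num: "y_num q = q ^ 2 * y"
    using units_nonzero[OF q(2)] q by (auto simp: x_num_def y_num_def x_def y_def P Q field_simps eval_nat_numeral)
  have "q ^ 6 * (x ^ 2 - 5 * x * y - 10 * x - y ^ 3 - 5 * y ^ 2 - 17 * y - 27) = F_pos q"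
    unfolding F_pos_eq x_num y_num by algebra
  then have F: "x ^ 2 - 5 * x * y - 10 * x - y ^ 3 - 5 * y ^ 2 - 17 * y - 27 = 0"
    using F_pos_eq_0[OF q(2)] q(1) by simp
  \<comment> \<open>These power sums turn the claimed identity into F(x, y) = 0.\<close>
  have pow: "P ^ 2 + 1 / P ^ 2 = x ^ 2 - 2" "Q ^ 2 + 1 / Q ^ 2 = y ^ 2 - 2" "Q ^ 3 + 1 / Q ^ 3 = y ^ 3 - 3 * y"
    using PQ by (auto simp: x_def y_def field_simps power2_eq_square power3_eq_cube)
  show ?thesis unfolding pow x_def[symmetric] y_def[symmetric] using F by (simp add: algebra_simps)
qed

end
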